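(* Let $\mathbb F$ be a field and let $q\in\mathbb F$ be nonzero and not a root of $1$. The following (i), (ii) hold for all $0\neq\theta\in\mathbb F$ and $t\in\mathbb Z$. (i) Assume that $\theta^2=q$. Under the primary (resp. secondary) identification of type $(\theta,t)$ the automorphism $L$ (resp. $L^\vee$) sends $$n_x\mapsto y^{-1}n_zy^{-1},\qquad y\mapsto y^{-1},\qquad n_z\mapsto n_x$$ and $L^{-1}$ (resp. $(L^\vee)^{-1}$) sends $$n_x\mapsto n_z,\qquad y\mapsto y^{-1},\qquad n_z\mapsto y^{-1}n_xy^{-1}.$$ (ii) Assume that $\theta^2=q^{-1}$. Under the primary (resp. secondary) identification of type $(\theta,t)$ the automorphism $L^\vee$ (resp. $L$) sends $$n_x\mapsto y^{-1}n_zy^{-1},\qquad y\mapsto y^{-1},\qquad n_z\mapsto n_x$$ and $(L^\vee)^{-1}$ (resp. $L^{-1}$) sends $$n_x\mapsto n_z,\qquad y\mapsto y^{-1},\qquad n_z\mapsto y^{-1}n_xy^{-1}.$$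
   Context: Chevalley presentation: $U_q(\mathfrak{sl}_2)$ is the $\mathbb F$-algebra (associative, unital) with generators $e,f,k^{\pm1}$ and relations $kk^{-1}=k^{-1}k=1$, $ke=q^2ek$, $kf=q^{-2}fk$, $ef-fe=(k-k^{-1})/(q-q^{-1})$. Lusztig automorphisms: $L$ is the $\mathbb F$-algebra automorphism of $U_q(\mathfrak{sl}_2)$ sending $e\mapsto -fk$, $f\mapsto -k^{-1}e$, $k\mapsto k^{-1}$; $L^\vee$ is the $\mathbb F$-algebra automorphism sending $e\mapsto -kf$, $f\mapsto -ek^{-1}$, $k\mapsto k^{-1}$. Equitable presentation: $U_q(\mathfrak{sl}_2)$ is isomorphic to the $\mathbb F$-algebra with generators $x,y^{\pm1},z$ and relations $yy^{-1}=y^{-1}y=1$, $\frac{qxy-q^{-1}yx}{q-q^{-1}}=1$, $\frac{qyz-q^{-1}zy}{q-q^{-1}}=1$, $\frac{qzx-q^{-1}xz}{q-q^{-1}}=1$. For $0\neq\theta\in\mathbb F$ and $t\in\mathbb Z$, the primary identification of type $(\theta,t)$ identifies the two algebras via the isomorphism $x\mapsto k^{-1}-k^{-1-t}e\,q^{1+t}(q-q^{-1})\theta^{-1}$, $y^{\pm1}\mapsto k^{\pm1}$, $z\mapsto k^{-1}+fk^tq^{-t}(q-q^{-1})\theta$; the secondary identification of type $(\theta,t)$ identifies them via the isomorphism $x\mapsto k-k^{1+t}f\,q^{1+t}(q-q^{-1})\theta^{-1}$, $y^{\pm1}\mapsto k^{\mp1}$, $z\mapsto k+ek^{-t}q^{-t}(q-q^{-1})\theta$.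 Elements: $n_x=\frac{q(1-yz)}{q-q^{-1}}$, $n_z=\frac{q(1-xy)}{q-q^{-1}}$. (The algebra is generated by $n_x,y^{\pm1},n_z$.) *)

theory Defs
  imports "HOL-Library.Poly_Mapping" "HOL-Algebra.QuotRing" "HOL-Algebra.Module"
begin

text \<open>
  The free associative unital algebra is the monoid algebra of the free monoid of words.
  Words are wrapped in a datatype because the product of \<open>Poly_Mapping\<close> convolves along the
  addition of a \<^class>\<open>monoid_add\<close>; here that (noncommutative) addition is concatenation.
\<close>

datatype 'g free_monoid = Word (letters: "'g list")

instantiation free_monoid :: (type) monoid_add
begin

definition "0 = Word []"
definition "u + v = Word (letters u @ letters v)"

instance
  by standard (simp_all add: zero_free_monoid_def plus_free_monoid_def)

end

type_synonym ('a, 'g) free_alg = "'g free_monoid \<Rightarrow>\<^sub>0 'a"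

definition gen :: "'g \<Rightarrow> ('a::field, 'g) free_alg" where
  "gen g = Poly_Mapping.single (Word [g]) 1"

definition scal :: "'a \<Rightarrow> ('a::field, 'g) free_alg" where
  "scal c = Poly_Mapping.single 0 c"

definition free_algebra :: "('a::field, ('a, 'g) free_alg) module" where
  "free_algebra =
    \<lparr>carrier = UNIV, mult = (*), one = 1, zero = 0, add = (+), smult = (\<lambda>c w. scal c * w)\<rparr>"

text \<open>
  The quotient of the free algebra by the two-sided ideal generated by \<open>R\<close>, i.e. the algebra
  with relations \<open>r = 0\<close> for \<open>r \<in> R\<close>.  It is \<^const>\<open>FactRing\<close> together with the scalar
  multiplication induced on cosets.
\<close>

definition relation_ideal :: "('a::field, 'g) free_alg set \<Rightarrow> ('a, 'g) free_alg set" where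
  "relation_ideal R = Idl\<^bsub>free_algebra\<^esub> R"

definition residue_class ::
    "('a::field, 'g) free_alg set \<Rightarrow> ('a, 'g) free_alg \<Rightarrow> ('a, 'g) free_alg set" where
  "residue_class R w = relation_ideal R +>\<^bsub>free_algebra\<^esub> w"

definition presented_algebra ::
    "('a::field, 'g) free_alg set \<Rightarrow> ('a, ('a, 'g) free_alg set) module" where
  "presented_algebra R =
    ring.extend (free_algebra Quot relation_ideal R)
      (module.fields (\<lambda>c X. \<Union>w\<in>X. residue_class R (c \<odot>\<^bsub>free_algebra\<^esub> w)))"

text \<open>
  Homomorphisms of (not necessarily commutative) unital algebras over the field \<open>'a\<close>; the locale
  \<^locale>\<open>algebra\<close> of the library covers commutative algebras only.  Isomorphisms are
  \<^const>\<open>extensional\<close> so that one is determined by its values on the carrier.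
\<close>

definition alg_hom :: "('a, 'b) module \<Rightarrow> ('a, 'c) module \<Rightarrow> ('b \<Rightarrow> 'c) set" where
  "alg_hom A B =
    {h \<in> ring_hom A B. \<forall>c. \<forall>a \<in> carrier A. h (c \<odot>\<^bsub>A\<^esub> a) = c \<odot>\<^bsub>B\<^esub> h a}"

definition alg_iso :: "('a, 'b) module \<Rightarrow> ('a, 'c) module \<Rightarrow> ('b \<Rightarrow> 'c) set" where
  "alg_iso A B =
    {h \<in> alg_hom A B \<inter> extensional (carrier A). bij_betw h (carrier A) (carrier B)}"

datatype chevalley_gen = E | F | K | Kinv

definition chevalley_relations :: "'a::field \<Rightarrow> ('a, chevalley_gen) free_alg set" where
  "chevalley_relations q =
    {gen K * gen Kinv - 1,
     gen Kinv * gen K - 1,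
     gen K * gen E - scal (q powi 2) * gen E * gen K,
     gen K * gen F - scal (q powi (-2)) * gen F * gen K,
     gen E * gen F - gen F * gen E - scal (1 / (q - inverse q)) * (gen K - gen Kinv)}"

definition Uq :: "'a::field \<Rightarrow> ('a, ('a, chevalley_gen) free_alg set) module" where
  "Uq q = presented_algebra (chevalley_relations q)"

definition chev :: "'a::field \<Rightarrow> chevalley_gen \<Rightarrow> ('a, chevalley_gen) free_alg set" where
  "chev q g = residue_class (chevalley_relations q) (gen g)"

text \<open>
  The definite descriptions below denote the intended maps only because an extensional isomorphism
  with the listed values exists and is unique.
\<close>

definition lusztig ::
    "'a::field \<Rightarrow> ('a, chevalley_gen) free_alg set \<Rightarrow> ('a, chevalley_gen) free_alg set" where
  "lusztig q = (THE L. L \<in> alg_iso (Uq q) (Uq q) \<and>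
     L (chev q E) = \<ominus>\<^bsub>Uq q\<^esub> (chev q F \<otimes>\<^bsub>Uq q\<^esub> chev q K) \<and>
     L (chev q F) = \<ominus>\<^bsub>Uq q\<^esub> (chev q Kinv \<otimes>\<^bsub>Uq q\<^esub> chev q E) \<and>
     L (chev q K) = chev q Kinv)"

definition lusztig_dual ::
    "'a::field \<Rightarrow> ('a, chevalley_gen) free_alg set \<Rightarrow> ('a, chevalley_gen) free_alg set" where
  "lusztig_dual q = (THE L. L \<in> alg_iso (Uq q) (Uq q) \<and>
     L (chev q E) = \<ominus>\<^bsub>Uq q\<^esub> (chev q K \<otimes>\<^bsub>Uq q\<^esub> chev q F) \<and>
     L (chev q F) = \<ominus>\<^bsub>Uq q\<^esub> (chev q E \<otimes>\<^bsub>Uq q\<^esub> chev q Kinv) \<and>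
     L (chev q K) = chev q Kinv)"

datatype equitable_gen = X | Y | Yinv | Z

definition equitable_relations :: "'a::field \<Rightarrow> ('a, equitable_gen) free_alg set" where
  "equitable_relations q =
    {gen Y * gen Yinv - 1,
     gen Yinv * gen Y - 1,
     scal (1 / (q - inverse q)) * (scal q * gen X * gen Y - scal (inverse q) * gen Y * gen X) - 1,
     scal (1 / (q - inverse q)) * (scal q * gen Y * gen Z - scal (inverse q) * gen Z * gen Y) - 1,
     scal (1 / (q - inverse q)) * (scal q * gen Z * gen X - scal (inverse q) * gen X * gen Z) - 1}"

definition Ueq :: "'a::field \<Rightarrow> ('a, ('a, equitable_gen) free_alg set) module" where
  "Ueq q = presented_algebra (equitable_relations q)"

definition equit :: "'a::field \<Rightarrow> equitable_gen \<Rightarrow> ('a, equitable_gen) free_alg set" where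
  "equit q g = residue_class (equitable_relations q) (gen g)"

definition nx :: "'a::field \<Rightarrow> ('a, equitable_gen) free_alg set" where
  "nx q = (q / (q - inverse q)) \<odot>\<^bsub>Ueq q\<^esub>
     (\<one>\<^bsub>Ueq q\<^esub> \<ominus>\<^bsub>Ueq q\<^esub> (equit q Y \<otimes>\<^bsub>Ueq q\<^esub> equit q Z))"

definition nz :: "'a::field \<Rightarrow> ('a, equitable_gen) free_alg set" where
  "nz q = (q / (q - inverse q)) \<odot>\<^bsub>Ueq q\<^esub>
     (\<one>\<^bsub>Ueq q\<^esub> \<ominus>\<^bsub>Ueq q\<^esub> (equit q X \<otimes>\<^bsub>Ueq q\<^esub> equit q Y))"

definition primary_id ::
    "'a::field \<Rightarrow> 'a \<Rightarrow> int \<Rightarrow> ('a, equitable_gen) free_alg set \<Rightarrow> ('a, chevalley_gen) free_alg set"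
  where
  "primary_id q \<theta> t = (THE \<phi>. \<phi> \<in> alg_iso (Ueq q) (Uq q) \<and>
     \<phi> (equit q X) = chev q Kinv \<ominus>\<^bsub>Uq q\<^esub>
       (q powi (1 + t) * (q - inverse q) * inverse \<theta>) \<odot>\<^bsub>Uq q\<^esub>
         ((chev q K [^]\<^bsub>Uq q\<^esub> (- 1 - t)) \<otimes>\<^bsub>Uq q\<^esub> chev q E) \<and>
     \<phi> (equit q Y) = chev q K \<and>
     \<phi> (equit q Yinv) = chev q Kinv \<and>
     \<phi> (equit q Z) = chev q Kinv \<oplus>\<^bsub>Uq q\<^esub>
       (q powi (- t) * (q - inverse q) * \<theta>) \<odot>\<^bsub>Uq q\<^esub>
         (chev q F \<otimes>\<^bsub>Uq q\<^esub> (chev q K [^]\<^bsub>Uq q\<^esub> t)))"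

definition secondary_id ::
    "'a::field \<Rightarrow> 'a \<Rightarrow> int \<Rightarrow> ('a, equitable_gen) free_alg set \<Rightarrow> ('a, chevalley_gen) free_alg set"
  where
  "secondary_id q \<theta> t = (THE \<phi>. \<phi> \<in> alg_iso (Ueq q) (Uq q) \<and>
     \<phi> (equit q X) = chev q K \<ominus>\<^bsub>Uq q\<^esub>
       (q powi (1 + t) * (q - inverse q) * inverse \<theta>) \<odot>\<^bsub>Uq q\<^esub>
         ((chev q K [^]\<^bsub>Uq q\<^esub> (1 + t)) \<otimes>\<^bsub>Uq q\<^esub> chev q F) \<and>
     \<phi> (equit q Y) = chev q Kinv \<and>
     \<phi> (equit q Yinv) = chev q K \<and>
     \<phi> (equit q Z) = chev q K \<oplus>\<^bsub>Uq q\<^esub>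
       (q powi (- t) * (q - inverse q) * \<theta>) \<odot>\<^bsub>Uq q\<^esub>
         (chev q E \<otimes>\<^bsub>Uq q\<^esub> (chev q K [^]\<^bsub>Uq q\<^esub> (- t))))"

text \<open>
  Under the identification \<open>\<phi>\<close> of \<^term>\<open>Ueq q\<close> with \<^term>\<open>Uq q\<close>, a self-map \<open>M\<close> of
  \<^term>\<open>Uq q\<close> sends \<open>a\<close> to \<open>b\<close>, where \<open>a\<close> and \<open>b\<close> are elements of \<^term>\<open>Ueq q\<close>.
\<close>

definition sends_under :: "('b \<Rightarrow> 'c) \<Rightarrow> ('c \<Rightarrow> 'c) \<Rightarrow> 'b \<Rightarrow> 'b \<Rightarrow> bool" where
  "sends_under \<phi> M a b \<longleftrightarrow> M (\<phi> a) = \<phi> b"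

end

theory Submission
  imports Defs "HOL-Algebra.Multiplicative_Group"
begin

text \<open>
  Write \<open>e, f, k, k'\<close> for the Chevalley generators, \<open>k'\<close> being the inverse of \<open>k\<close>.  Under the primary
  identification of type \<open>(\<theta>, t)\<close> the elements \<open>n\<^sub>x\<close>, \<open>y\<close>, \<open>n\<^sub>z\<close> become monomials with scalar
  coefficients:
  \<open>n\<^sub>x = - q\<^bsup>- 1 - t\<^esup> \<theta> f k\<^bsup>1 + t\<^esup>\<close>, \<open>y = k\<close> and \<open>n\<^sub>z = q\<^bsup>- t\<^esup> \<theta>\<^bsup>- 1\<^esup> e k\<^bsup>- t\<^esup>\<close>.
  Both Lusztig automorphisms have the shape \<open>e \<mapsto> - c f k\<close>, \<open>f \<mapsto> - c\<^bsup>- 1\<^esup> k' e\<close>, \<open>k \<mapsto> k'\<close>,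
  with \<open>c = 1\<close> for \<open>L\<close> and \<open>c = q\<^bsup>- 2\<^esup>\<close> for its dual.  Such a map therefore carries \<open>n\<^sub>z\<close> to a
  multiple of \<open>n\<^sub>x\<close>, and \<open>n\<^sub>x\<close> to a multiple of \<open>y\<^bsup>- 1\<^esup> n\<^sub>z y\<^bsup>- 1\<^esup>\<close>; comparing coefficients, both
  multiples are \<open>1\<close> exactly when \<open>\<theta>\<^sup>2 = q c\<close>, that is \<open>\<theta>\<^sup>2 = q\<close> or \<open>\<theta>\<^sup>2 = q\<^bsup>- 1\<^esup>\<close> in the two cases.
  The statements on inverses follow by applying the map to the claimed values.  This calculation is
  \<open>equitable_flip_of_images\<close>.

  The secondary identification is the same calculation in other letters.  The tuple
  \<open>(f, e, k', k)\<close> satisfies the Chevalley relations whenever \<open>(e, f, k, k')\<close> does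
  (\<open>chevalley_swap\<close>); in terms of the swapped tuple the secondary identification reads like the
  primary one and the two Lusztig automorphisms trade places.  For this reason the calculation is
  made for an arbitrary tuple satisfying the Chevalley relations in an arbitrary algebra.

  The maps in question are given by definite descriptions, so they have to be constructed.  An
  algebra given by generators and relations has the usual universal property
  (\<open>presented_algebra_hom_exists\<close>, \<open>presented_algebra_hom_unique\<close>).  All maps are composites of
  three isomorphisms: the swap; the twist \<open>e \<mapsto> c k\<^bsup>- t\<^esup> e\<close>, \<open>f \<mapsto> c\<^bsup>- 1\<^esup> f k\<^bsup>t\<^esup>\<close>, \<open>k \<mapsto> k\<close>; and the
  primary identification of type \<open>(1, 0)\<close>.  The first two are inverted by a map of the same kind.
  For the third, put \<open>x = y\<^bsup>- 1\<^esup> - \<xi>\<close> and \<open>z = y\<^bsup>- 1\<^esup> + \<zeta>\<close>: in terms of \<open>\<xi>\<close>, \<open>y\<close>, \<open>\<zeta>\<close> the equitable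
  relations turn into Chevalley relations up to rescaling (\<open>equitable_left_iff\<close>,
  \<open>equitable_right_iff\<close>, \<open>equitable_outer_iff\<close>), so the isomorphism can be read off in both
  directions.
\<close>

section \<open>Unital algebras over a field\<close>

text \<open>
  Noncommutative algebras: scalars act centrally, expressed by the last two axioms, and as simplification
  rules these move every scalar to the front of a product.
\<close>

locale unital_algebra = ring A for A :: "('a::field, 'b) module" (structure) +
  assumes smult_closed [intro, simp]: "x \<in> carrier A \<Longrightarrow> c \<odot> x \<in> carrier A"
    and smult_one [simp]: "x \<in> carrier A \<Longrightarrow> 1 \<odot> x = x"
    and smult_smult [simp]: "x \<in> carrier A \<Longrightarrow> c \<odot> (d \<odot> x) = (c * d) \<odot> x"
    and smult_l_distr: "x \<in> carrier A \<Longrightarrow> (c + d) \<odot> x = c \<odot> x \<oplus> d \<odot> x"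
    and smult_r_distr: "x \<in> carrier A \<Longrightarrow> y \<in> carrier A \<Longrightarrow> c \<odot> (x \<oplus> y) = c \<odot> x \<oplus> c \<odot> y"
    and smult_mult_left [simp]:
      "x \<in> carrier A \<Longrightarrow> y \<in> carrier A \<Longrightarrow> (c \<odot> x) \<otimes> y = c \<odot> (x \<otimes> y)"
    and smult_mult_right [simp]:
      "x \<in> carrier A \<Longrightarrow> y \<in> carrier A \<Longrightarrow> x \<otimes> (c \<odot> y) = c \<odot> (x \<otimes> y)"
begin

lemma smult_zero_left [simp]:
  assumes "x \<in> carrier A"
  shows "0 \<odot> x = \<zero>"
proof -
  have "0 \<odot> x \<oplus> 0 \<odot> x = 0 \<odot> x \<oplus> \<zero>"
    using smult_l_distr[of x 0 0] assms by simp
  then show ?thesis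
    using assms by (metis add.l_cancel_one' smult_closed r_zero)
qed

lemma smult_zero_right [simp]: "c \<odot> \<zero> = \<zero>"
  using smult_smult[of \<zero> c 0] by simp

lemma minus_eq_smult:
  assumes "x \<in> carrier A"
  shows "\<ominus> x = (- 1) \<odot> x"
proof (rule minus_equality)
  show "(- 1) \<odot> x \<oplus> x = \<zero>"
    using smult_l_distr[of x "- 1" 1] assms by simp
qed (use assms in auto)

lemma smult_minus: "x \<in> carrier A \<Longrightarrow> c \<odot> (\<ominus> x) = (- c) \<odot> x"
  by (simp add: minus_eq_smult)

lemma minus_smult: "x \<in> carrier A \<Longrightarrow> \<ominus> (c \<odot> x) = (- c) \<odot> x"
  by (simp add: minus_eq_smult)

end

section \<open>Algebras given by generators and relations\<close>

lemma free_algebra_simps [simp]: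
  "carrier free_algebra = UNIV" "mult free_algebra = (*)" "one free_algebra = 1"
  "zero free_algebra = 0" "add free_algebra = (+)" "c \<odot>\<^bsub>free_algebra\<^esub> w = scal c * w"
  by (simp_all add: free_algebra_def)

lemma free_algebra_ring: "ring (free_algebra :: ('a::field, ('a, 'g) free_alg) module)"
proof (rule ringI)
  show "abelian_group (free_algebra :: ('a, ('a, 'g) free_alg) module)"
  proof (rule abelian_groupI)
    fix x :: "('a, 'g) free_alg"
    show "\<exists>y\<in>carrier free_algebra. y \<oplus>\<^bsub>free_algebra\<^esub> x = \<zero>\<^bsub>free_algebra\<^esub>"
      by (auto intro: exI[of _ "- x"])
  qed (simp_all add: add_ac)
  show "monoid (free_algebra :: ('a, ('a, 'g) free_alg) module)"
    by (rule monoidI) (auto simp: mult.assoc)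
qed (auto simp: algebra_simps)

lemma free_algebra_a_inv [simp]:
  fixes w :: "('a::field, 'g) free_alg"
  shows "\<ominus>\<^bsub>free_algebra\<^esub> w = - w"
proof -
  interpret ring "free_algebra :: ('a, ('a, 'g) free_alg) module"
    by (rule free_algebra_ring)
  show ?thesis
    using minus_equality[of "- w" w] by simp
qed

lemma relation_ideal_ideal: "ideal (relation_ideal R) free_algebra"
  unfolding relation_ideal_def using ring.genideal_ideal[OF free_algebra_ring] by simp

lemma relation_ideal_self: "r \<in> R \<Longrightarrow> r \<in> relation_ideal R"
  unfolding relation_ideal_def using ring.genideal_self[OF free_algebra_ring, of R] by auto

lemma residue_class_eq_iff:
  fixes R :: "('a::field, 'g) free_alg set"
  shows "residue_class R v = residue_class R w \<longleftrightarrow> v - w \<in> relation_ideal R"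
proof -
  interpret ideal "relation_ideal R" free_algebra
    by (rule relation_ideal_ideal)
  show ?thesis
    using quotient_eq_iff_same_a_r_cos[OF relation_ideal_ideal, of v w R]
    by (simp add: residue_class_def a_minus_def)
qed

lemma free_alg_induct [case_names single add]:
  fixes w :: "('a::field, 'g) free_alg"
  assumes single: "\<And>u c. P (Poly_Mapping.single u c)"
    and add: "\<And>v w. P v \<Longrightarrow> P w \<Longrightarrow> P (v + w)"
  shows "P w"
proof (induction w rule: update_induct)
  case const
  show ?case using single[of 0 0] by simp
next
  case (update f u b)
  have "Poly_Mapping.update u b f = Poly_Mapping.single u b + f"
    using update(1) by (intro poly_mapping_eqI)
      (auto simp: lookup_add lookup_single lookup_update in_keys_iff when_def)
  then show ?case
    using single add update by simp
qed

lemma scal_central: "w * scal c = scal c * w"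
  by (induction w rule: free_alg_induct)
    (simp_all add: scal_def mult_single mult.commute distrib_left distrib_right)

lemma scal_left_commute: "v * (scal c * w) = scal c * (v * w)"
  by (simp add: scal_central flip: mult.assoc)

lemma scal_add: "scal (c + d) = scal c + scal d"
  by (simp add: scal_def single_add)

lemma scal_mult: "scal (c * d) = scal c * scal d"
  by (simp add: scal_def mult_single)

lemma scal_one [simp]: "scal 1 = 1"
  by (simp add: scal_def)

context
  fixes R :: "('a::field, 'g) free_alg set"
begin

interpretation I: ideal "relation_ideal R" free_algebra
  by (rule relation_ideal_ideal)

lemma presented_algebra_carrier: "carrier (presented_algebra R) = range (residue_class R)"
  by (auto simp: presented_algebra_def ring.defs module.defs FactRing_def A_RCOSETS_def'
      residue_class_def)

lemma residue_class_closed [simp]: "residue_class R w \<in> carrier (presented_algebra R)"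
  by (simp add: presented_algebra_carrier)

lemma residue_class_zero: "\<zero>\<^bsub>presented_algebra R\<^esub> = residue_class R 0"
  using I.a_coset_add_zero[of "relation_ideal R"]
  by (simp add: presented_algebra_def ring.defs module.defs FactRing_def residue_class_def)

lemma residue_class_one: "\<one>\<^bsub>presented_algebra R\<^esub> = residue_class R 1"
  by (simp add: presented_algebra_def ring.defs module.defs FactRing_def residue_class_def)

lemma residue_class_add:
  "residue_class R v \<oplus>\<^bsub>presented_algebra R\<^esub> residue_class R w = residue_class R (v + w)"
  using I.a_rcos_sum[of v w]
  by (simp add: presented_algebra_def ring.defs module.defs FactRing_def residue_class_def)

lemma residue_class_mult:
  "residue_class R v \<otimes>\<^bsub>presented_algebra R\<^esub> residue_class R w = residue_class R (v * w)"
  using I.rcoset_mult_add[of v w]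
  by (simp add: presented_algebra_def ring.defs module.defs FactRing_def residue_class_def)

lemma residue_class_self: "w \<in> residue_class R w"
  using I.a_rcos_self[of w] by (simp add: residue_class_def)

lemma mem_residue_class: "v \<in> residue_class R w \<longleftrightarrow> residue_class R v = residue_class R w"
  using I.a_rcos_module[of w v]
  unfolding residue_class_eq_iff by (simp add: residue_class_def)

text \<open>
  The scalar multiplication of the quotient is a union over all representatives of the class; all
  members of that union coincide because the ideal absorbs scalars.
\<close>

lemma residue_class_smult:
  "c \<odot>\<^bsub>presented_algebra R\<^esub> residue_class R w = residue_class R (scal c * w)"
proof -
  have "residue_class R (scal c * v) = residue_class R (scal c * w)"
    if "v \<in> residue_class R w" for v
  proof -
    have "v - w \<in> relation_ideal R"
      using that unfolding mem_residue_class residue_class_eq_iff .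
    then have "scal c * (v - w) \<in> relation_ideal R"
      using I.I_l_closed[of "v - w" "scal c"] by simp
    then show ?thesis
      unfolding residue_class_eq_iff right_diff_distrib .
  qed
  then have "(\<Union>v\<in>residue_class R w. residue_class R (scal c * v)) = residue_class R (scal c * w)"
    using residue_class_self[of w] by (intro UN_constant_eq) blast+
  then show ?thesis
    by (simp only: presented_algebra_def ring.defs module.defs module.select_convs free_algebra_simps)
qed

end

lemmas residue_class_simps =
  residue_class_zero residue_class_one residue_class_add residue_class_mult residue_class_smult

theorem presented_algebra_unital_algebra:
  fixes R :: "('a::field, 'g) free_alg set"
  shows "unital_algebra (presented_algebra R)"
proof -
  have "abelian_group (presented_algebra R)"
  proof (rule abelian_groupI)
    fix x assume "x \<in> carrier (presented_algebra R)"
    then obtain w where "x = residue_class R w"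
      by (auto simp: presented_algebra_carrier)
    then show "\<exists>y\<in>carrier (presented_algebra R). y \<oplus>\<^bsub>presented_algebra R\<^esub> x = \<zero>\<^bsub>presented_algebra R\<^esub>"
      by (intro bexI[of _ "residue_class R (- w)"]) (simp_all add: residue_class_simps)
  qed (auto simp: presented_algebra_carrier residue_class_simps add_ac)
  moreover have "monoid (presented_algebra R)"
    by (rule monoidI) (auto simp: presented_algebra_carrier residue_class_simps mult.assoc)
  ultimately have "ring (presented_algebra R)"
    by (rule ringI) (auto simp: presented_algebra_carrier residue_class_simps algebra_simps)
  then interpret P: ring "presented_algebra R" .
  show ?thesis
  proof
    fix x y c
    assume "x \<in> carrier (presented_algebra R)" "y \<in> carrier (presented_algebra R)"
    then obtain v w where "x = residue_class R v" "y = residue_class R w"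
      by (auto simp: presented_algebra_carrier)
    then show "x \<otimes>\<^bsub>presented_algebra R\<^esub> (c \<odot>\<^bsub>presented_algebra R\<^esub> y) =
        c \<odot>\<^bsub>presented_algebra R\<^esub> (x \<otimes>\<^bsub>presented_algebra R\<^esub> y)"
      by (simp add: residue_class_simps scal_left_commute[of v c w])
  qed (auto simp: presented_algebra_carrier residue_class_simps scal_add scal_mult distrib_left
        distrib_right mult.assoc)
qed

lemma residue_class_diff:
  "residue_class R v \<ominus>\<^bsub>presented_algebra R\<^esub> residue_class R w = residue_class R (v - w)"
proof -
  interpret unital_algebra "presented_algebra R"
    by (rule presented_algebra_unital_algebra)
  have "residue_class R (v - w) \<oplus>\<^bsub>presented_algebra R\<^esub> residue_class R w = residue_class R v"
    by (simp add: residue_class_add)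
  then show ?thesis
    using add.inv_solve_right[of "residue_class R (v - w)" "residue_class R v" "residue_class R w"]
    by (simp add: a_minus_def)
qed

lemma residue_class_relation:
  "v - w \<in> R \<Longrightarrow> residue_class R v = residue_class R w"
  by (simp add: residue_class_eq_iff relation_ideal_self)

section \<open>Evaluation of noncommutative polynomials\<close>

context unital_algebra
begin

definition word_value :: "('g \<Rightarrow> 'b) \<Rightarrow> 'g free_monoid \<Rightarrow> 'b" where
  "word_value g u = foldr (\<lambda>x y. g x \<otimes> y) (letters u) \<one>"

definition evaluation :: "('g \<Rightarrow> 'b) \<Rightarrow> ('a, 'g) free_alg \<Rightarrow> 'b" where
  "evaluation g w = (\<Oplus>u\<in>Poly_Mapping.keys w. Poly_Mapping.lookup w u \<odot> word_value g u)"

context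
  fixes g :: "'g \<Rightarrow> 'b"
  assumes g_closed [simp]: "\<And>x. g x \<in> carrier A"
begin

lemma word_value_closed [simp]: "word_value g u \<in> carrier A"
proof -
  have "foldr (\<lambda>x y. g x \<otimes> y) xs \<one> \<in> carrier A" for xs
    by (induction xs) auto
  then show ?thesis
    by (simp add: word_value_def)
qed

lemma word_value_add: "word_value g (u + v) = word_value g u \<otimes> word_value g v"
proof -
  have closed: "foldr (\<lambda>x y. g x \<otimes> y) xs \<one> \<in> carrier A" for xs
    by (induction xs) auto
  have "foldr (\<lambda>x y. g x \<otimes> y) (xs @ ys) \<one> =
      foldr (\<lambda>x y. g x \<otimes> y) xs \<one> \<otimes> foldr (\<lambda>x y. g x \<otimes> y) ys \<one>" for xs ys
    by (induction xs) (simp_all add: closed m_assoc del: foldr_append)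
  then show ?thesis
    by (simp add: word_value_def plus_free_monoid_def del: foldr_append)
qed

lemma evaluation_closed [simp]: "evaluation g w \<in> carrier A"
  by (auto simp: evaluation_def intro!: finsum_closed)

text \<open>
  Sums of polynomials change the set of keys; extending the summation to a common finite superset
  is what makes evaluation additive.
\<close>

lemma evaluation_superset:
  assumes "finite S" "Poly_Mapping.keys w \<subseteq> S"
  shows "evaluation g w = (\<Oplus>u\<in>S. Poly_Mapping.lookup w u \<odot> word_value g u)"
  unfolding evaluation_def
  by (rule add.finprod_mono_neutral_cong_left) (use assms in \<open>auto simp: in_keys_iff\<close>)

lemma evaluation_add: "evaluation g (v + w) = evaluation g v \<oplus> evaluation g w"
proof -
  let ?S = "Poly_Mapping.keys v \<union> Poly_Mapping.keys w"
  have "evaluation g (v + w) =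
      (\<Oplus>u\<in>?S. Poly_Mapping.lookup v u \<odot> word_value g u \<oplus> Poly_Mapping.lookup w u \<odot> word_value g u)"
    using keys_add[of v w]
    by (subst evaluation_superset[where S = ?S]) (auto simp: lookup_add smult_l_distr)
  also have "\<dots> = evaluation g v \<oplus> evaluation g w"
    by (subst finsum_addf) (auto simp: evaluation_superset[where S = ?S])
  finally show ?thesis .
qed

lemma evaluation_single: "evaluation g (Poly_Mapping.single u c) = c \<odot> word_value g u"
proof -
  have "evaluation g (Poly_Mapping.single u c) =
      (\<Oplus>v\<in>{u}. Poly_Mapping.lookup (Poly_Mapping.single u c) v \<odot> word_value g v)"
    by (rule evaluation_superset) auto
  then show ?thesis
    by (simp add: lookup_single)
qed

lemma evaluation_zero [simp]: "evaluation g 0 = \<zero>"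
  by (simp add: evaluation_def)

lemma evaluation_mult: "evaluation g (v * w) = evaluation g v \<otimes> evaluation g w"
proof (induction v rule: free_alg_induct)
  case (single u c)
  show ?case
    by (induction w rule: free_alg_induct)
      (simp_all add: mult_single evaluation_single word_value_add distrib_left evaluation_add r_distr
        mult.commute)
next
  case (add v v')
  then show ?case
    by (simp add: distrib_right evaluation_add l_distr)
qed

lemma evaluation_scal: "evaluation g (scal c) = c \<odot> \<one>"
  by (simp add: scal_def evaluation_single word_value_def zero_free_monoid_def)

lemma evaluation_one: "evaluation g 1 = \<one>"
  using evaluation_scal[of 1] by simp

lemma evaluation_gen: "evaluation g (gen x) = g x"
  by (simp add: gen_def evaluation_single word_value_def)

lemma evaluation_minus: "evaluation g (- w) = \<ominus> evaluation g w"
  using evaluation_add[of "- w" w] by (intro minus_equality[symmetric]) simp_all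

lemma evaluation_diff: "evaluation g (v - w) = evaluation g v \<ominus> evaluation g w"
  using evaluation_add[of v "- w"] by (simp add: evaluation_minus minus_eq)

lemmas evaluation_simps = evaluation_add evaluation_mult evaluation_scal evaluation_one
  evaluation_gen evaluation_diff

lemma evaluation_kernel_ideal: "ideal {w. evaluation g w = \<zero>} free_algebra"
proof (rule idealI[OF free_algebra_ring])
  show "subgroup {w. evaluation g w = \<zero>} (add_monoid free_algebra)"
    using ring.is_abelian_group[OF free_algebra_ring]
    by (intro group.subgroupI abelian_group.a_group)
      (auto simp: evaluation_add evaluation_minus free_algebra_a_inv[unfolded a_inv_def, simplified]
        intro: exI[of _ 0])
qed (auto simp: evaluation_mult)

text \<open>
  The polynomials that evaluate to zero form a two-sided ideal, so evaluation factors through the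
  quotient as soon as it kills the relations themselves.
\<close>

lemma evaluation_relation_ideal:
  assumes "\<And>r. r \<in> R \<Longrightarrow> evaluation g r = \<zero>" "w \<in> relation_ideal R"
  shows "evaluation g w = \<zero>"
  using ring.genideal_minimal[OF free_algebra_ring evaluation_kernel_ideal, of R] assms
  by (auto simp: relation_ideal_def)

end

end

section \<open>Homomorphisms\<close>

locale unital_algebra_hom = A: unital_algebra A + B: unital_algebra B
  for A :: "('a::field, 'b) module" and B :: "('a, 'c) module" +
  fixes h :: "'b \<Rightarrow> 'c"
  assumes hom: "h \<in> alg_hom A B"
begin

lemma hom_ring: "h \<in> ring_hom A B"
  using hom by (simp add: alg_hom_def)

lemma hom_closed [simp]: "x \<in> carrier A \<Longrightarrow> h x \<in> carrier B"
  using hom_ring by (rule ring_hom_closed)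

lemma hom_mult [simp]:
  "x \<in> carrier A \<Longrightarrow> y \<in> carrier A \<Longrightarrow> h (x \<otimes>\<^bsub>A\<^esub> y) = h x \<otimes>\<^bsub>B\<^esub> h y"
  using hom_ring by (rule ring_hom_mult)

lemma hom_add [simp]:
  "x \<in> carrier A \<Longrightarrow> y \<in> carrier A \<Longrightarrow> h (x \<oplus>\<^bsub>A\<^esub> y) = h x \<oplus>\<^bsub>B\<^esub> h y"
  using hom_ring by (rule ring_hom_add)

lemma hom_one [simp]: "h \<one>\<^bsub>A\<^esub> = \<one>\<^bsub>B\<^esub>"
  using hom_ring by (rule ring_hom_one)

lemma hom_smult [simp]: "x \<in> carrier A \<Longrightarrow> h (c \<odot>\<^bsub>A\<^esub> x) = c \<odot>\<^bsub>B\<^esub> h x"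
  using hom by (simp add: alg_hom_def)

lemma hom_minus [simp]: "x \<in> carrier A \<Longrightarrow> h (\<ominus>\<^bsub>A\<^esub> x) = \<ominus>\<^bsub>B\<^esub> h x"
  by (simp add: A.minus_eq_smult B.minus_eq_smult)

lemma hom_diff [simp]:
  "x \<in> carrier A \<Longrightarrow> y \<in> carrier A \<Longrightarrow> h (x \<ominus>\<^bsub>A\<^esub> y) = h x \<ominus>\<^bsub>B\<^esub> h y"
  by (simp add: a_minus_def)

end

lemma alg_hom_comp:
  assumes "h \<in> alg_hom A B" "g \<in> alg_hom B C"
  shows "g \<circ> h \<in> alg_hom A C"
  using assms unfolding alg_hom_def
  by (auto intro: ring_hom_trans simp: ring_hom_closed)

lemma alg_hom_cong:
  assumes "h \<in> alg_hom A B" "unital_algebra A" "\<And>x. x \<in> carrier A \<Longrightarrow> h' x = h x"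
  shows "h' \<in> alg_hom A B"
proof -
  interpret unital_algebra A by fact
  show ?thesis
    using assms(1,3) by (auto simp: alg_hom_def ring_hom_def Pi_iff)
qed

lemma id_alg_hom: "id \<in> alg_hom A A"
  by (simp add: alg_hom_def)

section \<open>The universal property of a presented algebra\<close>

lemma presented_algebra_hom_exists:
  fixes R :: "('a::field, 'g) free_alg set"
  assumes "unital_algebra A" and g: "\<And>x. g x \<in> carrier A"
    and rel: "\<And>r. r \<in> R \<Longrightarrow> unital_algebra.evaluation A g r = \<zero>\<^bsub>A\<^esub>"
  shows "\<exists>h\<in>alg_hom (presented_algebra R) A. \<forall>x. h (residue_class R (gen x)) = g x"
proof -
  interpret A: unital_algebra A by fact
  \<comment> \<open>Evaluate any representative; the relations make the choice immaterial.\<close>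
  define h where "h X = A.evaluation g (SOME w. X = residue_class R w)" for X
  have h: "h (residue_class R w) = A.evaluation g w" for w
  proof -
    let ?v = "SOME v. residue_class R w = residue_class R v"
    have "residue_class R w = residue_class R ?v"
      by (rule someI) (rule refl)
    then have "w - ?v \<in> relation_ideal R"
      by (simp only: residue_class_eq_iff)
    then have "A.evaluation g (w - ?v) = \<zero>\<^bsub>A\<^esub>"
      using A.evaluation_relation_ideal[of g R] g rel by blast
    then show ?thesis
      using g by (simp add: h_def A.evaluation_diff A.r_right_minus_eq)
  qed
  have "h \<in> alg_hom (presented_algebra R) A"
    unfolding alg_hom_def ring_hom_def
    by (auto simp: presented_algebra_carrier residue_class_simps h g A.evaluation_simps)
  moreover have "h (residue_class R (gen x)) = g x" for x
    by (simp add: h A.evaluation_gen g)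
  ultimately show ?thesis by blast
qed

lemma presented_algebra_hom_unique:
  fixes R :: "('a::field, 'g) free_alg set"
  assumes "unital_algebra A" and h: "h \<in> alg_hom (presented_algebra R) A"
    and h': "h' \<in> alg_hom (presented_algebra R) A"
    and gens: "\<And>x. h (residue_class R (gen x)) = h' (residue_class R (gen x))"
    and a: "a \<in> carrier (presented_algebra R)"
  shows "h a = h' a"
proof -
  interpret h: unital_algebra_hom "presented_algebra R" A h
    using assms presented_algebra_unital_algebra
    by (intro unital_algebra_hom.intro unital_algebra_hom_axioms.intro)
  interpret h': unital_algebra_hom "presented_algebra R" A h'
    using assms presented_algebra_unital_algebra
    by (intro unital_algebra_hom.intro unital_algebra_hom_axioms.intro)
  have word: "h (residue_class R (Poly_Mapping.single (Word xs) 1)) =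
      h' (residue_class R (Poly_Mapping.single (Word xs) 1))" for xs
  proof (induction xs)
    case Nil
    have "Poly_Mapping.single (Word []) 1 = (1 :: ('a, 'g) free_alg)"
      by (simp flip: zero_free_monoid_def)
    then show ?case
      by (simp flip: residue_class_one)
  next
    case (Cons x xs)
    have "Poly_Mapping.single (Word (x # xs)) 1 =
        (gen x * Poly_Mapping.single (Word xs) 1 :: ('a, 'g) free_alg)"
      by (simp add: gen_def mult_single plus_free_monoid_def)
    then show ?case
      using Cons by (simp add: gens flip: residue_class_mult)
  qed
  have "h (residue_class R w) = h' (residue_class R w)" for w
  proof (induction w rule: free_alg_induct)
    case (single u c)
    have "Poly_Mapping.single u c = scal c * Poly_Mapping.single u 1"
      by (simp add: scal_def mult_single)
    then show ?case
      using word[of "letters u"] by (simp flip: residue_class_smult)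
  next
    case (add v w)
    then show ?case
      by (simp flip: residue_class_add)
  qed
  then show ?thesis
    using a by (auto simp: presented_algebra_carrier)
qed

section \<open>Integer powers of an invertible element\<close>

lemma (in monoid) units_of_int_pow:
  fixes t :: int
  assumes "x \<in> Units G"
  shows "x [^]\<^bsub>units_of G\<^esub> t = x [^] t"
proof -
  interpret u: group "units_of G" by (rule units_group)
  have "x [^]\<^bsub>units_of G\<^esub> n \<in> Units G" for n :: nat
    using u.nat_pow_closed[of x n] assms by (simp add: units_of_carrier)
  then show ?thesis
    using assms unfolding int_pow_def2 by (simp add: units_of_inv units_of_pow del: pow_nat)
qed

locale inverse_pair = unital_algebra A for A :: "('a::field, 'b) module" (structure) +
  fixes k k' :: 'b
  assumes k_closed [simp]: "k \<in> carrier A" and k'_closed [simp]: "k' \<in> carrier A"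
    and k_k' [simp]: "k \<otimes> k' = \<one>" and k'_k [simp]: "k' \<otimes> k = \<one>"
begin

lemma inverse_pair_swap: "inverse_pair A k' k"
  by unfold_locales simp_all

lemma k_Units: "k \<in> Units A"
  by (auto simp: Units_def intro!: bexI[of _ k'])

lemma inv_k: "inv k = k'"
  by (rule inv_char) simp_all

text \<open>
  Once \<open>k\<close> and \<open>k'\<close> are written as powers, a word in them collapses to a single power by adding
  exponents.
\<close>

definition kpow :: "int \<Rightarrow> 'b" where
  "kpow t = k [^] t"

lemma kpow_closed [simp]: "kpow t \<in> carrier A"
proof -
  interpret u: group "units_of A" by (rule units_group)
  show ?thesis
    using u.int_pow_closed[of k t] k_Units
    by (auto simp: kpow_def units_of_carrier units_of_int_pow)
qed

lemma kpow_add: "kpow (s + t) = kpow s \<otimes> kpow t"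
proof -
  interpret u: group "units_of A" by (rule units_group)
  show ?thesis
    using u.int_pow_mult[of k s t] k_Units
    by (simp add: kpow_def units_of_carrier units_of_int_pow units_of_mult)
qed

lemma kpow_0 [simp]: "kpow 0 = \<one>"
  by (simp add: kpow_def)

lemma kpow_1: "kpow 1 = k"
  unfolding kpow_def int_pow_def2 by simp

lemma kpow_m1: "kpow (- 1) = k'"
  unfolding kpow_def int_pow_def2 by (simp add: inv_k)

lemma kpow_kpow: "kpow s \<otimes> kpow t = kpow (s + t)"
  by (simp add: kpow_add)

lemma kpow_kpow_left: "x \<in> carrier A \<Longrightarrow> kpow s \<otimes> (kpow t \<otimes> x) = kpow (s + t) \<otimes> x"
  by (simp add: kpow_add m_assoc)

lemma k'_pow: "k' [^] (t :: int) = k [^] (- t)"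
proof -
  interpret u: group "units_of A" by (rule units_group)
  have "inv\<^bsub>units_of A\<^esub> k = k'"
    using k_Units by (simp add: units_of_inv inv_k)
  moreover have "k' \<in> Units A"
    using inverse_pair.k_Units[OF inverse_pair_swap] .
  ultimately show ?thesis
    using u.int_pow_inv[of k t] u.int_pow_neg[of k t] k_Units
    by (simp add: units_of_carrier units_of_int_pow)
qed

text \<open>
  An element that commutes with \<open>k\<close> up to a nonzero scalar commutes up to the inverse scalar with
  \<open>k'\<close>, so induction runs in both directions.
\<close>

lemma kpow_commute:
  assumes x: "x \<in> carrier A" and "c \<noteq> 0" and kx: "k \<otimes> x = c \<odot> (x \<otimes> k)"
  shows "kpow t \<otimes> x = (c powi t) \<odot> (x \<otimes> kpow t)"
proof -
  have "k' \<otimes> (k \<otimes> x \<otimes> k') = c \<odot> (k' \<otimes> (x \<otimes> k \<otimes> k'))"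
    using x kx by (simp add: m_assoc)
  moreover have "k' \<otimes> (k \<otimes> x \<otimes> k') = x \<otimes> k'"
    using x by (metis k'_closed k_closed k'_k l_one m_assoc m_closed)
  ultimately have "x \<otimes> k' = c \<odot> (k' \<otimes> x)"
    using x by (simp add: m_assoc)
  then have k'x: "k' \<otimes> x = inverse c \<odot> (x \<otimes> k')"
    using x \<open>c \<noteq> 0\<close> by simp
  show ?thesis
  proof (induction t rule: int_induct[where k = 0])
    case base
    then show ?case using x by simp
  next
    case (step1 i)
    have "kpow (i + 1) \<otimes> x = kpow i \<otimes> (k \<otimes> x)"
      using x by (simp add: kpow_add m_assoc kpow_1)
    also have "\<dots> = c \<odot> ((kpow i \<otimes> x) \<otimes> k)"
      using x by (simp add: kx m_assoc)
    also have "\<dots> = (c powi (i + 1)) \<odot> (x \<otimes> kpow (i + 1))"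
      using x \<open>c \<noteq> 0\<close> by (simp add: step1 kpow_add m_assoc power_int_add mult.commute kpow_1)
    finally show ?case .
  next
    case (step2 i)
    have "kpow (i + - 1) \<otimes> x = kpow i \<otimes> (k' \<otimes> x)"
      unfolding kpow_add using x by (simp add: m_assoc kpow_m1)
    also have "\<dots> = inverse c \<odot> ((kpow i \<otimes> x) \<otimes> k')"
      using x by (simp add: k'x m_assoc)
    also have "\<dots> = (c powi (i + - 1)) \<odot> (x \<otimes> (kpow i \<otimes> k'))"
      using x \<open>c \<noteq> 0\<close> by (simp add: step2 m_assoc power_int_diff field_simps)
    also have "kpow i \<otimes> k' = kpow (i + - 1)"
      unfolding kpow_add by (simp add: kpow_m1)
    finally show ?case by simp
  qed
qed

end

lemma (in unital_algebra_hom) hom_int_pow: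
  assumes "inverse_pair A k k'"
  shows "h (k [^]\<^bsub>A\<^esub> (t :: int)) = h k [^]\<^bsub>B\<^esub> t"
proof -
  interpret k: inverse_pair A k k' by fact
  interpret hk: inverse_pair B "h k" "h k'"
    using k.k_k' k.k'_k by unfold_locales (simp_all flip: hom_mult)
  have "h (k.kpow t) = hk.kpow t"
  proof (induction t rule: int_induct[where k = 0])
    case base
    then show ?case by simp
  next
    case (step1 i)
    then show ?case
      by (simp add: k.kpow_add hk.kpow_add k.kpow_1 hk.kpow_1)
  next
    case (step2 i)
    have "h (k.kpow (i + - 1)) = hk.kpow (i + - 1)"
      unfolding k.kpow_add hk.kpow_add
      by (simp add: step2 k.kpow_m1 hk.kpow_m1)
    then show ?case by simp
  qed
  then show ?thesis
    by (simp add: k.kpow_def hk.kpow_def)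
qed

lemma inverse_pair_unique:
  assumes "inverse_pair A k k'" "inverse_pair A k k''"
  shows "k' = k''"
  using inverse_pair.inv_k[OF assms(1)] inverse_pair.inv_k[OF assms(2)] by simp

section \<open>Tuples satisfying the Chevalley relations\<close>

locale chevalley_elements = inverse_pair A k k'
  for A :: "('a::field, 'b) module" (structure) and k k' +
  fixes q :: 'a and e f :: 'b
  assumes e_closed [simp]: "e \<in> carrier A" and f_closed [simp]: "f \<in> carrier A"
    and q_nonzero [simp]: "q \<noteq> 0"
    and q_neq_inverse [simp]: "q \<noteq> inverse q"
    and k_e: "k \<otimes> e = (q powi 2) \<odot> (e \<otimes> k)"
    and k_f: "k \<otimes> f = (q powi (- 2)) \<odot> (f \<otimes> k)"
    and e_f: "e \<otimes> f \<ominus> f \<otimes> e = (1 / (q - inverse q)) \<odot> (k \<ominus> k')"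
begin

lemma kpow_e: "kpow t \<otimes> e = (q powi (2 * t)) \<odot> (e \<otimes> kpow t)"
  using kpow_commute[OF e_closed _ k_e, of t] by (simp add: power_int_mult)

lemma kpow_f: "kpow t \<otimes> f = (q powi (- 2 * t)) \<odot> (f \<otimes> kpow t)"
  using kpow_commute[OF f_closed _ k_f, of t]
  by (simp add: power_int_mult power_int_minus power_int_inverse)

lemma kpow_e_left: "x \<in> carrier A \<Longrightarrow> kpow t \<otimes> (e \<otimes> x) = (q powi (2 * t)) \<odot> (e \<otimes> (kpow t \<otimes> x))"
  using kpow_e[of t] by (simp flip: m_assoc)

lemma kpow_f_left:
  "x \<in> carrier A \<Longrightarrow> kpow t \<otimes> (f \<otimes> x) = (q powi (- 2 * t)) \<odot> (f \<otimes> (kpow t \<otimes> x))"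
  using kpow_f[of t] by (simp flip: m_assoc)

text \<open>
  Moving all powers of \<open>k\<close> to the right gives monomials a normal form, and reduces the comparison
  of monomials to the comparison of their coefficients.
\<close>

lemmas normal_order = kpow_kpow kpow_kpow_left kpow_e kpow_f kpow_e_left kpow_f_left m_assoc

text \<open>
  The Cartan involution \<open>e \<leftrightarrow> f\<close>, \<open>k \<leftrightarrow> k'\<close>: the commutator and \<open>k - k'\<close> both change sign.
\<close>

lemma chevalley_swap: "chevalley_elements A k' k q f e"
proof (intro chevalley_elements.intro inverse_pair_swap chevalley_elements_axioms.intro)
  show "k' \<otimes> f = (q powi 2) \<odot> (f \<otimes> k')"
    unfolding kpow_m1[symmetric] by (simp add: normal_order)
  show "k' \<otimes> e = (q powi (- 2)) \<odot> (e \<otimes> k')"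
    unfolding kpow_m1[symmetric] by (simp add: normal_order)
  have "f \<otimes> e \<ominus> e \<otimes> f = \<ominus> (e \<otimes> f \<ominus> f \<otimes> e)"
    by (simp add: minus_eq minus_add a_comm)
  also have "\<dots> = (1 / (q - inverse q)) \<odot> (\<ominus> (k \<ominus> k'))"
    by (simp add: e_f smult_minus minus_smult)
  also have "\<ominus> (k \<ominus> k') = k' \<ominus> k"
    by (simp add: minus_eq minus_add a_comm)
  finally show "f \<otimes> e \<ominus> e \<otimes> f = (1 / (q - inverse q)) \<odot> (k' \<ominus> k)" .
qed simp_all

text \<open>
  In either product of the twisted elements the powers of \<open>k\<close> and the scalars cancel, because \<open>e f\<close>
  and \<open>f e\<close> commute with \<open>k\<close>; so the commutator is unchanged.  Twists account for both parameters of
  an identification of type \<open>(\<theta>, t)\<close>.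
\<close>

lemma chevalley_twist:
  fixes t :: int
  assumes "c \<noteq> 0"
  shows "chevalley_elements A k k' q (c \<odot> (k [^] (- t) \<otimes> e)) (inverse c \<odot> (f \<otimes> k [^] t))"
  unfolding kpow_def[symmetric]
proof (intro chevalley_elements.intro inverse_pair_axioms chevalley_elements_axioms.intro)
  have "kpow 1 \<otimes> (c \<odot> (kpow (- t) \<otimes> e)) = (q powi 2) \<odot> (c \<odot> (kpow (- t) \<otimes> e) \<otimes> kpow 1)"
    by (simp add: normal_order power_int_add field_simps)
  then show "k \<otimes> (c \<odot> (kpow (- t) \<otimes> e)) = (q powi 2) \<odot> (c \<odot> (kpow (- t) \<otimes> e) \<otimes> k)"
    by (simp only: kpow_1)
  have "kpow 1 \<otimes> (inverse c \<odot> (f \<otimes> kpow t)) =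
      (q powi (- 2)) \<odot> (inverse c \<odot> (f \<otimes> kpow t) \<otimes> kpow 1)"
    by (simp add: normal_order power_int_add field_simps)
  then show "k \<otimes> (inverse c \<odot> (f \<otimes> kpow t)) = (q powi (- 2)) \<odot> (inverse c \<odot> (f \<otimes> kpow t) \<otimes> k)"
    by (simp only: kpow_1)
  have "c \<odot> (kpow (- t) \<otimes> e) \<otimes> (inverse c \<odot> (f \<otimes> kpow t)) = e \<otimes> f"
    using assms by (simp add: normal_order power_int_minus field_simps)
  moreover have "inverse c \<odot> (f \<otimes> kpow t) \<otimes> (c \<odot> (kpow (- t) \<otimes> e)) = f \<otimes> e"
    using assms by (simp add: normal_order power_int_minus field_simps)
  ultimately show "c \<odot> (kpow (- t) \<otimes> e) \<otimes> (inverse c \<odot> (f \<otimes> kpow t)) \<ominus>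
      inverse c \<odot> (f \<otimes> kpow t) \<otimes> (c \<odot> (kpow (- t) \<otimes> e)) = (1 / (q - inverse q)) \<odot> (k \<ominus> k')"
    by (simp add: e_f)
qed simp_all

end

section \<open>Rewriting the equitable relations\<close>

context unital_algebra
begin

lemma smult_diff: "x \<in> carrier A \<Longrightarrow> (c - d) \<odot> x = c \<odot> x \<ominus> d \<odot> x"
  using smult_l_distr[of x c "- d"] by (simp add: minus_eq minus_smult)

lemma smult_r_diff: "x \<in> carrier A \<Longrightarrow> y \<in> carrier A \<Longrightarrow> c \<odot> (x \<ominus> y) = c \<odot> x \<ominus> c \<odot> y"
  by (simp add: minus_eq smult_r_distr smult_minus minus_smult)

lemma l_diff_distr:
  "x \<in> carrier A \<Longrightarrow> y \<in> carrier A \<Longrightarrow> z \<in> carrier A \<Longrightarrow> (x \<ominus> y) \<otimes> z = x \<otimes> z \<ominus> y \<otimes> z"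
  by (simp add: minus_eq l_distr l_minus)

lemma r_diff_distr:
  "x \<in> carrier A \<Longrightarrow> y \<in> carrier A \<Longrightarrow> z \<in> carrier A \<Longrightarrow> z \<otimes> (x \<ominus> y) = z \<otimes> x \<ominus> z \<otimes> y"
  by (simp add: minus_eq r_distr r_minus)

lemma smult_cancel:
  assumes "c \<noteq> 0" "x \<in> carrier A" "y \<in> carrier A"
  shows "c \<odot> x = c \<odot> y \<longleftrightarrow> x = y"
proof
  assume "c \<odot> x = c \<odot> y"
  then have "inverse c \<odot> (c \<odot> x) = inverse c \<odot> (c \<odot> y)"
    by simp
  then show "x = y"
    using assms by simp
qed simp

text \<open>
  Each equitable relation is brought to this form, where \<open>d\<close> collects everything but the leading
  multiple of the unit.
\<close>

lemma normalised_eq_one_iff: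
  assumes "b \<noteq> 0" "d \<in> carrier A"
  shows "(1 / b) \<odot> (b \<odot> \<one> \<oplus> d) = \<one> \<longleftrightarrow> d = \<zero>"
proof -
  have "(1 / b) \<odot> (b \<odot> \<one> \<oplus> d) = \<one> \<longleftrightarrow> b \<odot> ((1 / b) \<odot> (b \<odot> \<one> \<oplus> d)) = b \<odot> \<one>"
    using assms by (subst smult_cancel) simp_all
  also have "\<dots> \<longleftrightarrow> d = \<zero>"
    using assms by simp
  finally show ?thesis .
qed

lemma minus_diff: "x \<in> carrier A \<Longrightarrow> y \<in> carrier A \<Longrightarrow> x \<ominus> (x \<ominus> y) = y"
  by algebra

text \<open>
  When the relation between \<open>z\<close> and \<open>x\<close> is multiplied out, the mixed terms \<open>r\<close> and \<open>s\<close> occur in both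
  products and cancel.
\<close>

lemma cancel_cross:
  assumes "p \<in> carrier A" "p' \<in> carrier A" "r \<in> carrier A" "s \<in> carrier A" "u \<in> carrier A"
    "v \<in> carrier A"
  shows "(p \<oplus> s \<ominus> (r \<oplus> u)) \<ominus> (p' \<ominus> r \<oplus> (s \<ominus> v)) = (p \<ominus> p') \<oplus> (v \<ominus> u)"
  using assms by algebra

lemma shift_one:
  assumes "p \<in> carrier A" "p' \<in> carrier A" "r \<in> carrier A"
  shows "p \<oplus> r = p' \<oplus> (r \<ominus> (p' \<ominus> p))"
  using assms by algebra

lemma add_diff_cancel: "x \<in> carrier A \<Longrightarrow> y \<in> carrier A \<Longrightarrow> x \<oplus> (y \<ominus> x) = y"
  by algebra

lemma add_diff: "x \<in> carrier A \<Longrightarrow> y \<in> carrier A \<Longrightarrow> x \<oplus> y \<ominus> x = y"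
  by algebra

lemma diff_add: "x \<in> carrier A \<Longrightarrow> y \<in> carrier A \<Longrightarrow> x \<ominus> (x \<oplus> y) = \<ominus> y"
  by algebra

end

context inverse_pair
begin

context
  fixes q :: 'a
  assumes q [simp]: "q \<noteq> 0" "q \<noteq> inverse q"
begin

lemma q_cancel [simp]:
  "inverse q * (q * q) = q" "q * (inverse q * inverse q) = inverse q"
  by (simp_all add: field_simps)

text \<open>
  With \<open>x = k' - \<xi>\<close> the relation between \<open>x\<close> and \<open>y = k\<close> loses its constant term and says only
  that \<open>\<xi>\<close> commutes with \<open>k\<close> up to the factor by which a Chevalley element \<open>e\<close> does.
\<close>

lemma equitable_left_iff:
  assumes [simp]: "\<xi> \<in> carrier A"
  shows "(1 / (q - inverse q)) \<odot> (q \<odot> ((k' \<ominus> \<xi>) \<otimes> k) \<ominus> inverse q \<odot> (k \<otimes> (k' \<ominus> \<xi>))) = \<one> \<longleftrightarrow>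
    k \<otimes> \<xi> = (q powi 2) \<odot> (\<xi> \<otimes> k)"
proof -
  have "q \<odot> ((k' \<ominus> \<xi>) \<otimes> k) \<ominus> inverse q \<odot> (k \<otimes> (k' \<ominus> \<xi>)) =
      (q \<odot> \<one> \<ominus> q \<odot> (\<xi> \<otimes> k)) \<ominus> (inverse q \<odot> \<one> \<ominus> inverse q \<odot> (k \<otimes> \<xi>))"
    by (simp add: l_diff_distr r_diff_distr smult_r_diff)
  also have "\<dots> = (q \<odot> \<one> \<ominus> inverse q \<odot> \<one>) \<oplus> (inverse q \<odot> (k \<otimes> \<xi>) \<ominus> q \<odot> (\<xi> \<otimes> k))"
    by (simp add: minus_eq minus_add a_ac)
  also have "q \<odot> \<one> \<ominus> inverse q \<odot> \<one> = (q - inverse q) \<odot> \<one>"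
    by (simp add: smult_diff)
  finally have "(1 / (q - inverse q)) \<odot> (q \<odot> ((k' \<ominus> \<xi>) \<otimes> k) \<ominus> inverse q \<odot> (k \<otimes> (k' \<ominus> \<xi>))) = \<one> \<longleftrightarrow>
      inverse q \<odot> (k \<otimes> \<xi>) \<ominus> q \<odot> (\<xi> \<otimes> k) = \<zero>"
    by (simp add: normalised_eq_one_iff)
  also have "\<dots> \<longleftrightarrow> inverse q \<odot> (k \<otimes> \<xi>) = inverse q \<odot> ((q powi 2) \<odot> (\<xi> \<otimes> k))"
    by (simp add: power2_eq_square)
  also have "\<dots> \<longleftrightarrow> k \<otimes> \<xi> = (q powi 2) \<odot> (\<xi> \<otimes> k)"
    by (intro smult_cancel) simp_all
  finally show ?thesis .
qed

text \<open>Likewise \<open>\<zeta> = z - k'\<close> commutes with \<open>k\<close> up to the factor of a Chevalley element \<open>f\<close>.\<close>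

lemma equitable_right_iff:
  assumes [simp]: "\<zeta> \<in> carrier A"
  shows "(1 / (q - inverse q)) \<odot> (q \<odot> (k \<otimes> (k' \<oplus> \<zeta>)) \<ominus> inverse q \<odot> ((k' \<oplus> \<zeta>) \<otimes> k)) = \<one> \<longleftrightarrow>
    k \<otimes> \<zeta> = (q powi (- 2)) \<odot> (\<zeta> \<otimes> k)"
proof -
  have "q \<odot> (k \<otimes> (k' \<oplus> \<zeta>)) \<ominus> inverse q \<odot> ((k' \<oplus> \<zeta>) \<otimes> k) =
      (q \<odot> \<one> \<oplus> q \<odot> (k \<otimes> \<zeta>)) \<ominus> (inverse q \<odot> \<one> \<oplus> inverse q \<odot> (\<zeta> \<otimes> k))"
    by (simp add: l_distr r_distr smult_r_distr)
  also have "\<dots> = (q \<odot> \<one> \<ominus> inverse q \<odot> \<one>) \<oplus> (q \<odot> (k \<otimes> \<zeta>) \<ominus> inverse q \<odot> (\<zeta> \<otimes> k))"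
    by (simp add: minus_eq minus_add a_ac)
  also have "q \<odot> \<one> \<ominus> inverse q \<odot> \<one> = (q - inverse q) \<odot> \<one>"
    by (simp add: smult_diff)
  finally have "(1 / (q - inverse q)) \<odot> (q \<odot> (k \<otimes> (k' \<oplus> \<zeta>)) \<ominus> inverse q \<odot> ((k' \<oplus> \<zeta>) \<otimes> k)) = \<one> \<longleftrightarrow>
      q \<odot> (k \<otimes> \<zeta>) \<ominus> inverse q \<odot> (\<zeta> \<otimes> k) = \<zero>"
    by (simp add: normalised_eq_one_iff)
  also have "\<dots> \<longleftrightarrow> q \<odot> (k \<otimes> \<zeta>) = q \<odot> ((q powi (- 2)) \<odot> (\<zeta> \<otimes> k))"
    by (simp add: power_int_minus power2_eq_square)
  also have "\<dots> \<longleftrightarrow> k \<otimes> \<zeta> = (q powi (- 2)) \<odot> (\<zeta> \<otimes> k)"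
    by (intro smult_cancel) simp_all
  finally show ?thesis .
qed

text \<open>
  Given these commutation rules, the terms of the remaining relation that are linear in \<open>\<xi>\<close> or in \<open>\<zeta>\<close>
  cancel.  For \<open>\<xi>\<close> and \<open>\<zeta>\<close> proportional to \<open>k' e\<close> and \<open>f\<close>, what is left is a multiple of the
  commutator relation of \<open>e\<close> and \<open>f\<close>, multiplied by \<open>k'\<close> on the left.
\<close>

lemma equitable_outer_iff:
  assumes \<xi> [simp]: "\<xi> \<in> carrier A" and \<zeta> [simp]: "\<zeta> \<in> carrier A"
    and k\<xi>: "k \<otimes> \<xi> = (q powi 2) \<odot> (\<xi> \<otimes> k)" and k\<zeta>: "k \<otimes> \<zeta> = (q powi (- 2)) \<odot> (\<zeta> \<otimes> k)"
  shows "(1 / (q - inverse q)) \<odot>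
      (q \<odot> ((k' \<oplus> \<zeta>) \<otimes> (k' \<ominus> \<xi>)) \<ominus> inverse q \<odot> ((k' \<ominus> \<xi>) \<otimes> (k' \<oplus> \<zeta>))) = \<one> \<longleftrightarrow>
    inverse q \<odot> (\<xi> \<otimes> \<zeta>) \<ominus> q \<odot> (\<zeta> \<otimes> \<xi>) = (q - inverse q) \<odot> (\<one> \<ominus> k' \<otimes> k')"
proof -
  let ?b = "q - inverse q"
  have k'\<xi>: "k' \<otimes> \<xi> = inverse (q * q) \<odot> (\<xi> \<otimes> k')"
    using kpow_commute[OF \<xi> _ k\<xi>, of "- 1"]
    by (simp add: kpow_m1 power_int_minus power2_eq_square)
  have k'\<zeta>: "k' \<otimes> \<zeta> = (q * q) \<odot> (\<zeta> \<otimes> k')"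
    using kpow_commute[OF \<zeta> _ k\<zeta>, of "- 1"]
    by (simp add: kpow_m1 power_int_minus power2_eq_square)
  have cross: "q \<odot> (k' \<otimes> \<xi>) = inverse q \<odot> (\<xi> \<otimes> k')" "inverse q \<odot> (k' \<otimes> \<zeta>) = q \<odot> (\<zeta> \<otimes> k')"
    by (simp_all add: k'\<xi> k'\<zeta>)
  have "q \<odot> ((k' \<oplus> \<zeta>) \<otimes> (k' \<ominus> \<xi>)) \<ominus> inverse q \<odot> ((k' \<ominus> \<xi>) \<otimes> (k' \<oplus> \<zeta>)) =
      (q \<odot> (k' \<otimes> k') \<oplus> q \<odot> (\<zeta> \<otimes> k') \<ominus> (q \<odot> (k' \<otimes> \<xi>) \<oplus> q \<odot> (\<zeta> \<otimes> \<xi>))) \<ominus>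
      (inverse q \<odot> (k' \<otimes> k') \<ominus> inverse q \<odot> (\<xi> \<otimes> k') \<oplus>
        (inverse q \<odot> (k' \<otimes> \<zeta>) \<ominus> inverse q \<odot> (\<xi> \<otimes> \<zeta>)))"
    by (simp add: l_distr r_distr l_diff_distr r_diff_distr smult_r_distr smult_r_diff)
  also have "\<dots> = (q \<odot> (k' \<otimes> k') \<ominus> inverse q \<odot> (k' \<otimes> k')) \<oplus>
      (inverse q \<odot> (\<xi> \<otimes> \<zeta>) \<ominus> q \<odot> (\<zeta> \<otimes> \<xi>))"
    unfolding cross
    by (rule cancel_cross) simp_all
  also have "\<dots> = ?b \<odot> \<one> \<oplus> (inverse q \<odot> (\<xi> \<otimes> \<zeta>) \<ominus> q \<odot> (\<zeta> \<otimes> \<xi>) \<ominus> ?b \<odot> (\<one> \<ominus> k' \<otimes> k'))"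
    unfolding smult_diff[symmetric, OF m_closed[OF k'_closed k'_closed]]
      smult_r_diff[OF one_closed m_closed[OF k'_closed k'_closed]]
    by (rule shift_one) simp_all
  finally show ?thesis
    by (simp add: normalised_eq_one_iff)
qed

end

end

section \<open>Passing between Chevalley and equitable tuples\<close>

locale equitable_elements = inverse_pair A y y'
  for A :: "('a::field, 'b) module" (structure) and y y' +
  fixes q :: 'a and x z :: 'b
  assumes x_closed [simp]: "x \<in> carrier A" and z_closed [simp]: "z \<in> carrier A"
    and q_nonzero [simp]: "q \<noteq> 0" and q_neq_inverse [simp]: "q \<noteq> inverse q"
    and x_y: "(1 / (q - inverse q)) \<odot> (q \<odot> (x \<otimes> y) \<ominus> inverse q \<odot> (y \<otimes> x)) = \<one>"
    and y_z: "(1 / (q - inverse q)) \<odot> (q \<odot> (y \<otimes> z) \<ominus> inverse q \<odot> (z \<otimes> y)) = \<one>"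
    and z_x: "(1 / (q - inverse q)) \<odot> (q \<odot> (z \<otimes> x) \<ominus> inverse q \<odot> (x \<otimes> z)) = \<one>"

text \<open>
  The primary identification of type \<open>(1, 0)\<close>: here \<open>\<xi> = q (q - q\<^bsup>- 1\<^esup>) k' e\<close> and
  \<open>\<zeta> = (q - q\<^bsup>- 1\<^esup>) f\<close>.
\<close>

lemma (in chevalley_elements) equitable_of_chevalley:
  "equitable_elements A k k' q
    (k' \<ominus> (q * (q - inverse q)) \<odot> (k' \<otimes> e)) (k' \<oplus> (q - inverse q) \<odot> f)"
proof -
  define b where "b = q - inverse q"
  have [simp]: "b \<noteq> 0"
    by (simp add: b_def)
  let ?\<xi> = "(q * b) \<odot> (k' \<otimes> e)" and ?\<zeta> = "b \<odot> f"
  have k\<xi>: "k \<otimes> ?\<xi> = (q powi 2) \<odot> (?\<xi> \<otimes> k)"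
  proof -
    have "k \<otimes> (k' \<otimes> e) = (q powi 2) \<odot> (k' \<otimes> (e \<otimes> k))"
      using k_e by (metis e_closed k'_closed k'_k k_closed k_k' m_assoc m_closed smult_mult_right)
    then show ?thesis
      by (simp add: m_assoc mult_ac)
  qed
  have k\<zeta>: "k \<otimes> ?\<zeta> = (q powi (- 2)) \<odot> (?\<zeta> \<otimes> k)"
    using k_f by (simp add: mult_ac)
  have "f \<otimes> (k' \<otimes> e) = (q powi (- 2)) \<odot> (k' \<otimes> (f \<otimes> e))"
    unfolding kpow_m1[symmetric] by (simp add: normal_order power_int_minus)
  then have f_k'_e: "f \<otimes> (k' \<otimes> e) = inverse (q * q) \<odot> (k' \<otimes> (f \<otimes> e))"
    by (simp add: power_int_minus power2_eq_square)
  have "inverse q \<odot> (?\<xi> \<otimes> ?\<zeta>) \<ominus> q \<odot> (?\<zeta> \<otimes> ?\<xi>) =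
      (b * b) \<odot> (k' \<otimes> (e \<otimes> f)) \<ominus> (b * b) \<odot> (k' \<otimes> (f \<otimes> e))"
    by (simp add: m_assoc f_k'_e field_simps)
  also have "\<dots> = (b * b) \<odot> (k' \<otimes> (e \<otimes> f \<ominus> f \<otimes> e))"
    by (simp add: r_diff_distr smult_r_diff)
  also have "\<dots> = b \<odot> (\<one> \<ominus> k' \<otimes> k')"
    by (simp add: e_f[folded b_def] r_diff_distr)
  finally show ?thesis
    using k\<xi> k\<zeta> unfolding b_def
    by (intro equitable_elements.intro inverse_pair_axioms equitable_elements_axioms.intro
        equitable_left_iff[THEN iffD2] equitable_right_iff[THEN iffD2]
        equitable_outer_iff[THEN iffD2]) simp_all
qed

text \<open>The inverse passage: solve the two formulas for \<open>\<xi>\<close> and \<open>\<zeta>\<close> for \<open>e\<close> and \<open>f\<close>.\<close>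

lemma (in equitable_elements) chevalley_of_equitable:
  "chevalley_elements A y y' q
    (inverse (q * (q - inverse q)) \<odot> (y \<otimes> (y' \<ominus> x))) (inverse (q - inverse q) \<odot> (z \<ominus> y'))"
proof -
  define b where "b = q - inverse q"
  have [simp]: "b \<noteq> 0"
    by (simp add: b_def)
  define \<xi> \<zeta> where "\<xi> = y' \<ominus> x" and "\<zeta> = z \<ominus> y'"
  have [simp]: "\<xi> \<in> carrier A" "\<zeta> \<in> carrier A"
    by (simp_all add: \<xi>_def \<zeta>_def)
  have x: "x = y' \<ominus> \<xi>"
    by (simp add: \<xi>_def minus_diff)
  have z: "z = y' \<oplus> \<zeta>"
    by (simp add: \<zeta>_def add_diff_cancel)
  have y\<xi>: "y \<otimes> \<xi> = (q powi 2) \<odot> (\<xi> \<otimes> y)"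
    using x_y unfolding x by (simp add: equitable_left_iff del: power_int_numeral)
  have y\<zeta>: "y \<otimes> \<zeta> = (q powi (- 2)) \<odot> (\<zeta> \<otimes> y)"
    using y_z unfolding z by (simp add: equitable_right_iff)
  have \<xi>\<zeta>: "inverse q \<odot> (\<xi> \<otimes> \<zeta>) \<ominus> q \<odot> (\<zeta> \<otimes> \<xi>) = b \<odot> (\<one> \<ominus> y' \<otimes> y')"
    using z_x unfolding x z by (simp add: equitable_outer_iff y\<xi> y\<zeta> b_def)
  have [simp]: "q * q * (inverse q * inverse q) = 1"
    by (simp add: field_simps)
  have \<zeta>y: "\<zeta> \<otimes> y = (q * q) \<odot> (y \<otimes> \<zeta>)"
    by (simp add: y\<zeta> power_int_minus power2_eq_square)
  have \<zeta>y\<xi>: "\<zeta> \<otimes> (y \<otimes> \<xi>) = (q * q) \<odot> (y \<otimes> (\<zeta> \<otimes> \<xi>))"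
  proof -
    have "\<zeta> \<otimes> (y \<otimes> \<xi>) = (\<zeta> \<otimes> y) \<otimes> \<xi>"
      by (simp add: m_assoc)
    then show ?thesis
      unfolding \<zeta>y by (simp add: m_assoc)
  qed
  show ?thesis
    unfolding \<xi>_def[symmetric] \<zeta>_def[symmetric] b_def[symmetric]
  proof (intro chevalley_elements.intro inverse_pair_axioms chevalley_elements_axioms.intro)
    let ?e = "inverse (q * b) \<odot> (y \<otimes> \<xi>)" and ?f = "inverse b \<odot> \<zeta>"
    have "y \<otimes> (y \<otimes> \<xi>) = (q powi 2) \<odot> (y \<otimes> \<xi> \<otimes> y)"
      using arg_cong[OF y\<xi>, of "\<lambda>w. y \<otimes> w"] by (simp add: m_assoc)
    then show "y \<otimes> ?e = (q powi 2) \<odot> (?e \<otimes> y)"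
      by (simp add: mult_ac)
    show "y \<otimes> ?f = (q powi (- 2)) \<odot> (?f \<otimes> y)"
      by (simp add: y\<zeta> mult_ac)
    have "?e \<otimes> ?f \<ominus> ?f \<otimes> ?e = (inverse b * inverse b) \<odot>
        (y \<otimes> (inverse q \<odot> (\<xi> \<otimes> \<zeta>) \<ominus> q \<odot> (\<zeta> \<otimes> \<xi>)))"
      by (simp add: m_assoc \<zeta>y\<xi> r_diff_distr smult_r_diff field_simps)
    also have "\<dots> = (1 / b) \<odot> (y \<ominus> y')"
      unfolding \<xi>\<zeta> by (simp add: r_diff_distr field_simps flip: m_assoc)
    finally show "?e \<otimes> ?f \<ominus> ?f \<otimes> ?e = (1 / (q - inverse q)) \<odot> (y \<ominus> y')"
      by (simp only: b_def)
  qed simp_all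
qed

section \<open>Isomorphisms as extensional functions\<close>

lemma alg_isoI:
  assumes A: "unital_algebra A" and h: "h \<in> alg_hom A B" and g: "g \<in> alg_hom B A"
    and gh: "\<And>x. x \<in> carrier A \<Longrightarrow> g (h x) = x" and hg: "\<And>y. y \<in> carrier B \<Longrightarrow> h (g y) = y"
  shows "restrict h (carrier A) \<in> alg_iso A B"
proof -
  have closed: "\<And>x. x \<in> carrier A \<Longrightarrow> h x \<in> carrier B" "\<And>y. y \<in> carrier B \<Longrightarrow> g y \<in> carrier A"
    using h g by (auto simp: alg_hom_def ring_hom_closed)
  have "restrict h (carrier A) \<in> alg_hom A B"
    by (rule alg_hom_cong[OF h A]) simp
  moreover have "bij_betw (restrict h (carrier A)) (carrier A) (carrier B)"
    using closed gh hg by (intro bij_betw_byWitness[where f' = g]) auto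
  ultimately show ?thesis
    by (simp add: alg_iso_def)
qed

lemma alg_iso_hom: "h \<in> alg_iso A B \<Longrightarrow> h \<in> alg_hom A B"
  by (simp add: alg_iso_def)

lemma alg_iso_compose:
  assumes "unital_algebra A" "h \<in> alg_iso A B" "g \<in> alg_iso B C"
  shows "compose (carrier A) g h \<in> alg_iso A C"
proof -
  have "compose (carrier A) g h \<in> alg_hom A C"
    by (rule alg_hom_cong[OF alg_hom_comp[OF assms(2,3)[THEN alg_iso_hom]] assms(1)])
      (simp add: compose_def)
  moreover have "bij_betw (compose (carrier A) g h) (carrier A) (carrier C)"
    using assms(2,3) unfolding alg_iso_def by (blast intro: bij_betw_compose)
  ultimately show ?thesis
    by (simp add: alg_iso_def)
qed

lemma alg_iso_eqI:
  "h \<in> alg_iso A B \<Longrightarrow> h' \<in> alg_iso A B \<Longrightarrow> (\<And>x. x \<in> carrier A \<Longrightarrow> h x = h' x) \<Longrightarrow> h = h'"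
  unfolding alg_iso_def by (blast intro: extensionalityI)

section \<open>The two presentations\<close>

lemma Uq_unital_algebra: "unital_algebra (Uq q)"
  unfolding Uq_def by (rule presented_algebra_unital_algebra)

lemma Ueq_unital_algebra: "unital_algebra (Ueq q)"
  unfolding Ueq_def by (rule presented_algebra_unital_algebra)

lemma chev_chevalley_elements:
  assumes "q \<noteq> 0" "q \<noteq> inverse q"
  shows "chevalley_elements (Uq q) (chev q K) (chev q Kinv) q (chev q E) (chev q F)"
proof -
  let ?R = "chevalley_relations q"
  have rel: "residue_class ?R (gen K * gen Kinv) = residue_class ?R 1"
      "residue_class ?R (gen Kinv * gen K) = residue_class ?R 1"
      "residue_class ?R (gen K * gen E) = residue_class ?R (scal (q powi 2) * gen E * gen K)"
      "residue_class ?R (gen K * gen F) = residue_class ?R (scal (q powi (- 2)) * gen F * gen K)"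
      "residue_class ?R (gen E * gen F - gen F * gen E) =
        residue_class ?R (scal (1 / (q - inverse q)) * (gen K - gen Kinv))"
    by (rule residue_class_relation, simp add: chevalley_relations_def)+
  show ?thesis
    unfolding Uq_def chev_def
    by (intro chevalley_elements.intro inverse_pair.intro inverse_pair_axioms.intro
        chevalley_elements_axioms.intro presented_algebra_unital_algebra)
      (use assms rel in \<open>simp_all add: residue_class_simps residue_class_diff mult.assoc\<close>)
qed

lemma equit_equitable_elements:
  assumes "q \<noteq> 0" "q \<noteq> inverse q"
  shows "equitable_elements (Ueq q) (equit q Y) (equit q Yinv) q (equit q X) (equit q Z)"
proof -
  let ?R = "equitable_relations q"
  have rel: "residue_class ?R (gen Y * gen Yinv) = residue_class ?R 1"
      "residue_class ?R (gen Yinv * gen Y) = residue_class ?R 1"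
      "residue_class ?R (scal (1 / (q - inverse q)) *
        (scal q * gen X * gen Y - scal (inverse q) * gen Y * gen X)) = residue_class ?R 1"
      "residue_class ?R (scal (1 / (q - inverse q)) *
        (scal q * gen Y * gen Z - scal (inverse q) * gen Z * gen Y)) = residue_class ?R 1"
      "residue_class ?R (scal (1 / (q - inverse q)) *
        (scal q * gen Z * gen X - scal (inverse q) * gen X * gen Z)) = residue_class ?R 1"
    by (rule residue_class_relation, simp add: equitable_relations_def)+
  show ?thesis
    unfolding Ueq_def equit_def
    by (intro equitable_elements.intro inverse_pair.intro inverse_pair_axioms.intro
        equitable_elements_axioms.intro presented_algebra_unital_algebra)
      (use assms rel in \<open>simp_all add: residue_class_simps residue_class_diff mult.assoc\<close>)
qed

lemma Uq_hom_exists: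
  assumes "chevalley_elements A k k' q e f"
  shows "\<exists>h\<in>alg_hom (Uq q) A.
    h (chev q E) = e \<and> h (chev q F) = f \<and> h (chev q K) = k \<and> h (chev q Kinv) = k'"
proof -
  interpret chevalley_elements A k k' q e f by fact
  obtain g where g_gen: "g E = e" "g F = f" "g K = k" "g Kinv = k'"
    using that[of "case_chevalley_gen e f k k'"] by simp
  have g: "g x \<in> carrier A" for x
    by (cases x) (simp_all add: g_gen)
  have "evaluation g r = \<zero>\<^bsub>A\<^esub>" if "r \<in> chevalley_relations q" for r
    using that k_e k_f e_f
    by (auto simp: chevalley_relations_def evaluation_simps[OF g] g_gen m_assoc)
  then obtain h where "h \<in> alg_hom (Uq q) A" "\<And>x. h (chev q x) = g x"
    using presented_algebra_hom_exists[of A g "chevalley_relations q"] unital_algebra_axioms g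
    by (auto simp: Uq_def chev_def)
  then show ?thesis
    by (intro bexI[of _ h]) (simp_all add: g_gen)
qed

lemma Ueq_hom_exists:
  assumes "equitable_elements A y y' q x z"
  shows "\<exists>h\<in>alg_hom (Ueq q) A.
    h (equit q X) = x \<and> h (equit q Y) = y \<and> h (equit q Yinv) = y' \<and> h (equit q Z) = z"
proof -
  interpret equitable_elements A y y' q x z by fact
  obtain g where g_gen: "g X = x" "g Y = y" "g Yinv = y'" "g Z = z"
    using that[of "case_equitable_gen x y y' z"] by simp
  have g: "g u \<in> carrier A" for u
    by (cases u) (simp_all add: g_gen)
  have "evaluation g r = \<zero>\<^bsub>A\<^esub>" if "r \<in> equitable_relations q" for r
    using that x_y y_z z_x
    by (auto simp: equitable_relations_def evaluation_simps[OF g] g_gen m_assoc)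
  then obtain h where "h \<in> alg_hom (Ueq q) A" "\<And>x. h (equit q x) = g x"
    using presented_algebra_hom_exists[of A g "equitable_relations q"] unital_algebra_axioms g
    by (auto simp: Ueq_def equit_def)
  then show ?thesis
    by (intro bexI[of _ h]) (simp_all add: g_gen)
qed

lemma Uq_hom_unique:
  assumes "unital_algebra A" "h \<in> alg_hom (Uq q) A" "h' \<in> alg_hom (Uq q) A"
    and "h (chev q E) = h' (chev q E)" "h (chev q F) = h' (chev q F)"
      "h (chev q K) = h' (chev q K)" "h (chev q Kinv) = h' (chev q Kinv)"
    and "a \<in> carrier (Uq q)"
  shows "h a = h' a"
proof (rule presented_algebra_hom_unique[OF assms(1)])
  fix g show "h (residue_class (chevalley_relations q) (gen g)) =
      h' (residue_class (chevalley_relations q) (gen g))"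
    using assms by (cases g) (simp_all add: chev_def)
qed (use assms in \<open>simp_all add: Uq_def\<close>)

lemma Ueq_hom_unique:
  assumes "unital_algebra A" "h \<in> alg_hom (Ueq q) A" "h' \<in> alg_hom (Ueq q) A"
    and "h (equit q X) = h' (equit q X)" "h (equit q Y) = h' (equit q Y)"
      "h (equit q Yinv) = h' (equit q Yinv)" "h (equit q Z) = h' (equit q Z)"
    and "a \<in> carrier (Ueq q)"
  shows "h a = h' a"
proof (rule presented_algebra_hom_unique[OF assms(1)])
  fix g show "h (residue_class (equitable_relations q) (gen g)) =
      h' (residue_class (equitable_relations q) (gen g))"
    using assms by (cases g) (simp_all add: equit_def)
qed (use assms in \<open>simp_all add: Ueq_def\<close>)

lemma Ueq_iso_eqI:
  assumes "\<phi> \<in> alg_iso (Ueq q) A" "\<psi> \<in> alg_iso (Ueq q) A" "unital_algebra A"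
    and "\<phi> (equit q X) = \<psi> (equit q X)" "\<phi> (equit q Y) = \<psi> (equit q Y)"
      "\<phi> (equit q Yinv) = \<psi> (equit q Yinv)" "\<phi> (equit q Z) = \<psi> (equit q Z)"
  shows "\<phi> = \<psi>"
  using Ueq_hom_unique[OF assms(3) assms(1,2)[THEN alg_iso_hom] assms(4-7)]
  by (rule alg_iso_eqI[OF assms(1,2)])

section \<open>Transporting a Lusztig automorphism to the equitable side\<close>

text \<open>
  In \<open>1 - y z\<close> and \<open>1 - x y\<close> the constant terms cancel, which leaves one monomial each.
\<close>

lemma (in chevalley_elements) nx_nz_images:
  fixes t :: int
  assumes \<phi>: "\<phi> \<in> alg_hom (Ueq q) A"
    and X: "\<phi> (equit q X) = k' \<ominus> (q powi (1 + t) * (q - inverse q) * inverse \<theta>) \<odot> (k [^] (- 1 - t) \<otimes> e)"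
    and Y: "\<phi> (equit q Y) = k"
    and Z: "\<phi> (equit q Z) = k' \<oplus> (q powi (- t) * (q - inverse q) * \<theta>) \<odot> (f \<otimes> k [^] t)"
  shows "\<phi> (nx q) = (- (q powi (- 1 - t) * \<theta>)) \<odot> (f \<otimes> k [^] (1 + t))"
    and "\<phi> (nz q) = (q powi (- t) * inverse \<theta>) \<odot> (e \<otimes> k [^] (- t))"
proof -
  interpret EQ: equitable_elements "Ueq q" "equit q Y" "equit q Yinv" q "equit q X" "equit q Z"
    by (rule equit_equitable_elements) simp_all
  interpret \<phi>: unital_algebra_hom "Ueq q" A \<phi>
    by unfold_locales (rule \<phi>)
  define b where "b = q - inverse q"
  have b [simp]: "b \<noteq> 0"
    by (simp add: b_def)
  have kf: "kpow 1 \<otimes> (f \<otimes> kpow t) = (q powi (- 2)) \<odot> (f \<otimes> kpow (1 + t))"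
    by (simp add: normal_order)
  have ek: "kpow (- 1 - t) \<otimes> e \<otimes> kpow 1 = (q powi (2 * (- 1 - t))) \<odot> (e \<otimes> kpow (- t))"
    by (simp add: normal_order)
  have "\<phi> (nx q) = (q / b) \<odot> (\<one> \<ominus> k \<otimes> (k' \<oplus> (q powi (- t) * b * \<theta>) \<odot> (f \<otimes> kpow t)))"
    unfolding nx_def b_def kpow_def by (simp add: Y Z)
  also have "\<dots> = (q / b) \<odot> (\<one> \<ominus> (\<one> \<oplus> (q powi (- t) * b * \<theta>) \<odot> (k \<otimes> (f \<otimes> kpow t))))"
    by (simp add: r_distr)
  also have "\<dots> = (- (q / b) * (q powi (- t) * b * \<theta>)) \<odot> (k \<otimes> (f \<otimes> kpow t))"
    by (simp add: diff_add minus_smult)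
  also have "\<dots> = (- (q powi (- 1 - t) * \<theta>)) \<odot> (f \<otimes> kpow (1 + t))"
    using kf by (simp add: kpow_1 power_int_diff power_int_minus field_simps power2_eq_square)
  finally show "\<phi> (nx q) = (- (q powi (- 1 - t) * \<theta>)) \<odot> (f \<otimes> k [^] (1 + t))"
    by (simp only: kpow_def)
  have "\<phi> (nz q) = (q / b) \<odot> (\<one> \<ominus> (k' \<ominus> (q powi (1 + t) * b * inverse \<theta>) \<odot> (kpow (- 1 - t) \<otimes> e)) \<otimes> k)"
    unfolding nz_def b_def kpow_def by (simp add: X Y)
  also have "\<dots> = (q / b) \<odot> (\<one> \<ominus> (\<one> \<ominus> (q powi (1 + t) * b * inverse \<theta>) \<odot> (kpow (- 1 - t) \<otimes> e \<otimes> k)))"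
    by (simp add: l_diff_distr)
  also have "\<dots> = ((q / b) * (q powi (1 + t) * b * inverse \<theta>)) \<odot> (kpow (- 1 - t) \<otimes> e \<otimes> k)"
    by (simp add: minus_diff)
  also have "\<dots> = (q / b * (q powi (1 + t) * b * inverse \<theta>) * q powi (2 * (- 1 - t))) \<odot> (e \<otimes> kpow (- t))"
    using ek by (simp add: kpow_1)
  also have "q / b * (q powi (1 + t) * b * inverse \<theta>) * q powi (2 * (- 1 - t)) = q powi (- t) * inverse \<theta>"
  proof -
    have "q * q powi (1 + t) * q powi (2 * (- 1 - t)) = q powi (- t)"
      using power_int_add[of q 1 "1 + t"] power_int_add[of q "2 + t" "2 * (- 1 - t)"] by (simp add: algebra_simps)
    then show ?thesis by (simp add: mult_ac)
  qed
  finally show "\<phi> (nz q) = (q powi (- t) * inverse \<theta>) \<odot> (e \<otimes> k [^] (- t))"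
    by (simp only: kpow_def)
qed

text \<open>
  The action on \<open>n\<^sub>x\<close>, \<open>y\<close>, \<open>n\<^sub>z\<close> that is common to all four combinations of an identification and a
  Lusztig automorphism.
\<close>

definition equitable_flip ::
    "'a::field \<Rightarrow> ('a, 'c) module \<Rightarrow> (('a, equitable_gen) free_alg set \<Rightarrow> 'c) \<Rightarrow> ('c \<Rightarrow> 'c) \<Rightarrow> bool"
  where
  "equitable_flip q A \<phi> M \<longleftrightarrow>
    sends_under \<phi> M (nx q) (equit q Yinv \<otimes>\<^bsub>Ueq q\<^esub> nz q \<otimes>\<^bsub>Ueq q\<^esub> equit q Yinv) \<and>
    sends_under \<phi> M (equit q Y) (equit q Yinv) \<and>
    sends_under \<phi> M (nz q) (nx q) \<and>
    sends_under \<phi> (inv_into (carrier A) M) (nx q) (nz q) \<and>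
    sends_under \<phi> (inv_into (carrier A) M) (equit q Y) (equit q Yinv) \<and>
    sends_under \<phi> (inv_into (carrier A) M) (nz q)
      (equit q Yinv \<otimes>\<^bsub>Ueq q\<^esub> nx q \<otimes>\<^bsub>Ueq q\<^esub> equit q Yinv)"

text \<open>
  For arbitrary \<open>\<theta>\<close> the map \<open>M\<close> sends \<open>n\<^sub>x\<close> to \<open>\<theta>\<^sup>2 / (q c)\<close> times \<open>y\<^bsup>- 1\<^esup> n\<^sub>z y\<^bsup>- 1\<^esup>\<close>, and \<open>n\<^sub>z\<close> to
  \<open>q c / \<theta>\<^sup>2\<close> times \<open>n\<^sub>x\<close>; one condition on \<open>\<theta>\<^sup>2\<close> settles both.
\<close>

lemma (in chevalley_elements) equitable_flip_of_images:
  fixes t :: int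
  assumes M: "M \<in> alg_iso A A" and \<phi>: "\<phi> \<in> alg_hom (Ueq q) A"
    and Me: "M e = (- c) \<odot> (f \<otimes> k)" and Mf: "M f = (- inverse c) \<odot> (k' \<otimes> e)" and Mk: "M k = k'"
    and "c \<noteq> 0" "\<theta> \<noteq> 0" and \<theta>: "\<theta>\<^sup>2 = q * c"
    and X: "\<phi> (equit q X) = k' \<ominus> (q powi (1 + t) * (q - inverse q) * inverse \<theta>) \<odot> (k [^] (- 1 - t) \<otimes> e)"
    and Y: "\<phi> (equit q Y) = k"
    and Yinv: "\<phi> (equit q Yinv) = k'"
    and Z: "\<phi> (equit q Z) = k' \<oplus> (q powi (- t) * (q - inverse q) * \<theta>) \<odot> (f \<otimes> k [^] t)"
  shows "equitable_flip q A \<phi> M"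
proof -
  interpret EQ: equitable_elements "Ueq q" "equit q Y" "equit q Yinv" q "equit q X" "equit q Z"
    by (rule equit_equitable_elements) simp_all
  interpret \<phi>: unital_algebra_hom "Ueq q" A \<phi>
    by unfold_locales (rule \<phi>)
  interpret M: unital_algebra_hom A A M
    by unfold_locales (rule alg_iso_hom[OF M])
  note nx = nx_nz_images(1)[OF \<phi> X Y Z, folded kpow_def]
  note nz = nx_nz_images(2)[OF \<phi> X Y Z, folded kpow_def]
  have closed [simp]: "nx q \<in> carrier (Ueq q)" "nz q \<in> carrier (Ueq q)"
    unfolding nx_def nz_def by auto
  have Mkpow: "M (kpow s) = kpow (- s)" for s
    unfolding kpow_def by (simp add: M.hom_int_pow[OF inverse_pair_axioms] Mk k'_pow)
  have Mk': "M k' = k"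
    using Mkpow[of "- 1"] by (simp add: kpow_m1 kpow_1)
  \<comment> \<open>In this form the hypothesis can be substituted for a single occurrence of \<open>\<theta>\<close>.\<close>
  have \<theta>': "\<theta> = q * c * inverse \<theta>"
    using \<theta> \<open>\<theta> \<noteq> 0\<close> by (simp add: field_simps power2_eq_square)
  have M_nx: "M (\<phi> (nx q)) = k' \<otimes> \<phi> (nz q) \<otimes> k'"
  proof -
    have "M (\<phi> (nx q)) =
        (q powi (- 1 - t) * \<theta> * inverse c) \<odot> (kpow (- 1) \<otimes> e \<otimes> kpow (- (1 + t)))"
      by (simp add: nx Mf Mkpow kpow_m1)
    also have "\<dots> = (q powi (- 1 - t) * \<theta> * inverse c * q powi (- 2)) \<odot> (e \<otimes> kpow (- 2 - t))"
      by (simp add: normal_order)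
    also have "q powi (- 1 - t) * \<theta> * inverse c * q powi (- 2) =
        q powi (- t) * inverse \<theta> * q powi (- 2)"
      using \<open>c \<noteq> 0\<close> by (subst \<theta>') (simp add: power_int_diff power_int_minus field_simps)
    also have "\<dots> \<odot> (e \<otimes> kpow (- 2 - t)) = kpow (- 1) \<otimes> \<phi> (nz q) \<otimes> kpow (- 1)"
      by (simp add: nz normal_order)
    finally show ?thesis
      by (simp only: kpow_m1)
  qed
  have M_nz: "M (\<phi> (nz q)) = \<phi> (nx q)"
  proof -
    have "M (\<phi> (nz q)) = (- (q powi (- t) * inverse \<theta> * c)) \<odot> (f \<otimes> kpow 1 \<otimes> kpow t)"
      by (simp add: nz Me Mkpow kpow_1)
    also have "\<dots> = (- (q powi (- t) * inverse \<theta> * c)) \<odot> (f \<otimes> kpow (1 + t))"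
      by (simp add: normal_order)
    also have "q powi (- t) * inverse \<theta> * c = q powi (- 1 - t) * \<theta>"
      by (subst (2) \<theta>') (simp add: power_int_diff power_int_minus field_simps)
    finally show ?thesis
      by (simp only: nx)
  qed
  have inv: "inv_into (carrier A) M u = v" if "v \<in> carrier A" "M v = u" for u v
    using M that by (auto simp: alg_iso_def bij_betw_def intro: inv_into_f_eq)
  have "k \<otimes> (k' \<otimes> \<phi> (nz q) \<otimes> k') \<otimes> k = \<phi> (nz q)"
  proof -
    have "k \<otimes> (k' \<otimes> \<phi> (nz q) \<otimes> k') \<otimes> k = (k \<otimes> k') \<otimes> \<phi> (nz q) \<otimes> (k' \<otimes> k)"
      by (simp add: m_assoc del: k_k' k'_k)
    then show ?thesis by simp
  qed
  then have "M (k' \<otimes> \<phi> (nx q) \<otimes> k') = \<phi> (nz q)"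
    by (simp add: M_nx Mk')
  then show ?thesis
    using M_nx M_nz Mk Mk' by (simp add: equitable_flip_def sends_under_def Y Yinv inv)
qed

section \<open>Existence and uniqueness of the described maps\<close>

context
  fixes q :: "'a::field"
  assumes q [simp]: "q \<noteq> 0" "q \<noteq> inverse q"
begin

interpretation U: chevalley_elements "Uq q" "chev q K" "chev q Kinv" q "chev q E" "chev q F"
  by (rule chev_chevalley_elements) simp_all

interpretation EQ: equitable_elements "Ueq q" "equit q Y" "equit q Yinv" q "equit q X" "equit q Z"
  by (rule equit_equitable_elements) simp_all

lemma Uq_homI: "h \<in> alg_hom (Uq q) (Uq q) \<Longrightarrow> unital_algebra_hom (Uq q) (Uq q) h"
  by (intro unital_algebra_hom.intro unital_algebra_hom_axioms.intro Uq_unital_algebra)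

lemma swap_iso_exists:
  "\<exists>h\<in>alg_iso (Uq q) (Uq q). h (chev q E) = chev q F \<and> h (chev q F) = chev q E \<and>
    h (chev q K) = chev q Kinv \<and> h (chev q Kinv) = chev q K"
proof -
  obtain h where h: "h \<in> alg_hom (Uq q) (Uq q)" "h (chev q E) = chev q F"
      "h (chev q F) = chev q E" "h (chev q K) = chev q Kinv" "h (chev q Kinv) = chev q K"
    using Uq_hom_exists[OF U.chevalley_swap] by blast
  have "h (h a) = a" if "a \<in> carrier (Uq q)" for a
    using Uq_hom_unique[OF Uq_unital_algebra alg_hom_comp[OF h(1) h(1)] id_alg_hom _ _ _ _ that]
    by (simp add: h)
  then have "restrict h (carrier (Uq q)) \<in> alg_iso (Uq q) (Uq q)"
    by (intro alg_isoI[OF Uq_unital_algebra h(1) h(1)])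
  then show ?thesis
    by (rule bexI[rotated]) (simp add: h)
qed

lemma twist_iso_exists:
  fixes t :: int
  assumes "c \<noteq> 0"
  shows "\<exists>h\<in>alg_iso (Uq q) (Uq q).
    h (chev q E) = c \<odot>\<^bsub>Uq q\<^esub> (chev q K [^]\<^bsub>Uq q\<^esub> (- t) \<otimes>\<^bsub>Uq q\<^esub> chev q E) \<and>
    h (chev q F) = inverse c \<odot>\<^bsub>Uq q\<^esub> (chev q F \<otimes>\<^bsub>Uq q\<^esub> chev q K [^]\<^bsub>Uq q\<^esub> t) \<and>
    h (chev q K) = chev q K \<and> h (chev q Kinv) = chev q Kinv"
proof -
  have ex: "\<exists>h. h \<in> alg_hom (Uq q) (Uq q) \<and>
    h (chev q E) = c \<odot>\<^bsub>Uq q\<^esub> (U.kpow (- t) \<otimes>\<^bsub>Uq q\<^esub> chev q E) \<and>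
    h (chev q F) = inverse c \<odot>\<^bsub>Uq q\<^esub> (chev q F \<otimes>\<^bsub>Uq q\<^esub> U.kpow t) \<and>
    h (chev q K) = chev q K \<and> h (chev q Kinv) = chev q Kinv" if "c \<noteq> 0" for c t
    using Uq_hom_exists[OF U.chevalley_twist[OF that, of t]] unfolding U.kpow_def by blast
  have cancel: "g (h a) = a"
    if h: "h \<in> alg_hom (Uq q) (Uq q)" "h (chev q K) = chev q K" "h (chev q Kinv) = chev q Kinv"
      "h (chev q E) = c \<odot>\<^bsub>Uq q\<^esub> (U.kpow (- t) \<otimes>\<^bsub>Uq q\<^esub> chev q E)"
      "h (chev q F) = inverse c \<odot>\<^bsub>Uq q\<^esub> (chev q F \<otimes>\<^bsub>Uq q\<^esub> U.kpow t)"
    and g: "g \<in> alg_hom (Uq q) (Uq q)" "g (chev q K) = chev q K" "g (chev q Kinv) = chev q Kinv"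
      "g (chev q E) = d \<odot>\<^bsub>Uq q\<^esub> (U.kpow t \<otimes>\<^bsub>Uq q\<^esub> chev q E)"
      "g (chev q F) = inverse d \<odot>\<^bsub>Uq q\<^esub> (chev q F \<otimes>\<^bsub>Uq q\<^esub> U.kpow (- t))"
    and "c * d = 1" "a \<in> carrier (Uq q)" for h g c d t a
  proof -
    interpret g: unital_algebra_hom "Uq q" "Uq q" g
      using g(1) by (rule Uq_homI)
    have gk: "g (U.kpow s) = U.kpow s" for s
      unfolding U.kpow_def using g by (simp add: g.hom_int_pow[OF U.inverse_pair_axioms])
    have "inverse c * inverse d = 1"
      using \<open>c * d = 1\<close> by (metis inverse_1 inverse_mult_distrib)
    then show ?thesis
      using Uq_hom_unique[OF Uq_unital_algebra alg_hom_comp[OF h(1) g(1)] id_alg_hom _ _ _ _ \<open>a \<in> _\<close>]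
        \<open>c * d = 1\<close>
      by (simp add: h g gk U.kpow_kpow_left U.kpow_kpow U.m_assoc)
  qed
  obtain h where h: "h \<in> alg_hom (Uq q) (Uq q)" "h (chev q K) = chev q K" "h (chev q Kinv) = chev q Kinv"
      "h (chev q E) = c \<odot>\<^bsub>Uq q\<^esub> (U.kpow (- t) \<otimes>\<^bsub>Uq q\<^esub> chev q E)"
      "h (chev q F) = inverse c \<odot>\<^bsub>Uq q\<^esub> (chev q F \<otimes>\<^bsub>Uq q\<^esub> U.kpow t)"
    using ex[OF assms, of t] by blast
  obtain g where g: "g \<in> alg_hom (Uq q) (Uq q)" "g (chev q K) = chev q K" "g (chev q Kinv) = chev q Kinv"
      "g (chev q E) = inverse c \<odot>\<^bsub>Uq q\<^esub> (U.kpow t \<otimes>\<^bsub>Uq q\<^esub> chev q E)"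
      "g (chev q F) = c \<odot>\<^bsub>Uq q\<^esub> (chev q F \<otimes>\<^bsub>Uq q\<^esub> U.kpow (- t))"
    using ex[of "inverse c" "- t"] assms by auto
  have "restrict h (carrier (Uq q)) \<in> alg_iso (Uq q) (Uq q)"
  proof (rule alg_isoI[OF Uq_unital_algebra h(1) g(1)])
    show "g (h a) = a" if "a \<in> carrier (Uq q)" for a
      using cancel[of h c t g "inverse c" a] h g that assms by simp
    show "h (g a) = a" if "a \<in> carrier (Uq q)" for a
      using cancel[of g "inverse c" "- t" h c a] h g that assms by simp
  qed
  then show ?thesis
    by (rule bexI[rotated]) (simp add: h U.kpow_def)
qed

lemma equitable_iso_exists:
  "\<exists>h\<in>alg_iso (Ueq q) (Uq q).
    h (equit q X) = chev q Kinv \<ominus>\<^bsub>Uq q\<^esub>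
      (q * (q - inverse q)) \<odot>\<^bsub>Uq q\<^esub> (chev q Kinv \<otimes>\<^bsub>Uq q\<^esub> chev q E) \<and>
    h (equit q Y) = chev q K \<and> h (equit q Yinv) = chev q Kinv \<and>
    h (equit q Z) = chev q Kinv \<oplus>\<^bsub>Uq q\<^esub> (q - inverse q) \<odot>\<^bsub>Uq q\<^esub> chev q F"
proof -
  define b where "b = q - inverse q"
  have [simp]: "b \<noteq> 0"
    by (simp add: b_def)
  have [simp]: "q * b * (inverse q * inverse b) = 1" "inverse q * inverse b * (q * b) = 1"
    by (simp_all add: field_simps)
  obtain h where h: "h \<in> alg_hom (Ueq q) (Uq q)"
    "h (equit q X) = chev q Kinv \<ominus>\<^bsub>Uq q\<^esub> (q * b) \<odot>\<^bsub>Uq q\<^esub> (chev q Kinv \<otimes>\<^bsub>Uq q\<^esub> chev q E)"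
    "h (equit q Y) = chev q K" "h (equit q Yinv) = chev q Kinv"
    "h (equit q Z) = chev q Kinv \<oplus>\<^bsub>Uq q\<^esub> b \<odot>\<^bsub>Uq q\<^esub> chev q F"
    using Ueq_hom_exists[OF U.equitable_of_chevalley] unfolding b_def by blast
  obtain g where g: "g \<in> alg_hom (Uq q) (Ueq q)"
    "g (chev q E) = inverse (q * b) \<odot>\<^bsub>Ueq q\<^esub> (equit q Y \<otimes>\<^bsub>Ueq q\<^esub> (equit q Yinv \<ominus>\<^bsub>Ueq q\<^esub> equit q X))"
    "g (chev q F) = inverse b \<odot>\<^bsub>Ueq q\<^esub> (equit q Z \<ominus>\<^bsub>Ueq q\<^esub> equit q Yinv)"
    "g (chev q K) = equit q Y" "g (chev q Kinv) = equit q Yinv"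
    using Uq_hom_exists[OF EQ.chevalley_of_equitable] unfolding b_def by blast
  interpret h: unital_algebra_hom "Ueq q" "Uq q" h
    by unfold_locales (rule h)
  interpret g: unital_algebra_hom "Uq q" "Ueq q" g
    by unfold_locales (rule g)
  have gh: "g (h a) = a" if "a \<in> carrier (Ueq q)" for a
  proof -
    have "equit q Yinv \<otimes>\<^bsub>Ueq q\<^esub> (equit q Y \<otimes>\<^bsub>Ueq q\<^esub> (equit q Yinv \<ominus>\<^bsub>Ueq q\<^esub> equit q X)) =
        equit q Yinv \<ominus>\<^bsub>Ueq q\<^esub> equit q X"
      by (simp flip: EQ.m_assoc)
    then show ?thesis
      using Ueq_hom_unique[OF Ueq_unital_algebra alg_hom_comp[OF h(1) g(1)] id_alg_hom _ _ _ _ that]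
      by (simp add: h g EQ.minus_diff EQ.add_diff_cancel)
  qed
  have hg: "h (g a) = a" if "a \<in> carrier (Uq q)" for a
  proof -
    have "chev q K \<otimes>\<^bsub>Uq q\<^esub> (chev q Kinv \<otimes>\<^bsub>Uq q\<^esub> chev q E) = chev q E"
      by (simp flip: U.m_assoc)
    then show ?thesis
      using Uq_hom_unique[OF Uq_unital_algebra alg_hom_comp[OF g(1) h(1)] id_alg_hom _ _ _ _ that]
      by (simp add: h g U.minus_diff U.add_diff)
  qed
  have "restrict h (carrier (Ueq q)) \<in> alg_iso (Ueq q) (Uq q)"
    by (rule alg_isoI[OF Ueq_unital_algebra h(1) g(1) gh hg])
  then show ?thesis
    by (rule bexI[rotated]) (simp add: h b_def[symmetric])
qed

text \<open>
  The descriptions of the Lusztig automorphisms are silent about \<open>k'\<close>; its image is the inverse of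
  the image of \<open>k\<close>.
\<close>

lemma Uq_endo_Kinv:
  assumes "L \<in> alg_hom (Uq q) (Uq q)" "inverse_pair (Uq q) (L (chev q K)) k'"
  shows "L (chev q Kinv) = k'"
proof (rule inverse_pair_unique[OF _ assms(2)])
  interpret L: unital_algebra_hom "Uq q" "Uq q" L
    using assms(1) by (rule Uq_homI)
  show "inverse_pair (Uq q) (L (chev q K)) (L (chev q Kinv))"
    by unfold_locales (simp_all flip: L.hom_mult)
qed

lemma Uq_endo_eqI:
  assumes "L \<in> alg_iso (Uq q) (Uq q)" "L' \<in> alg_iso (Uq q) (Uq q)"
    and EFK: "L (chev q E) = L' (chev q E)" "L (chev q F) = L' (chev q F)"
      "L (chev q K) = L' (chev q K)"
  shows "L = L'"
proof -
  interpret L': unital_algebra_hom "Uq q" "Uq q" L'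
    using alg_iso_hom[OF assms(2)] by (rule Uq_homI)
  have "inverse_pair (Uq q) (L (chev q K)) (L' (chev q Kinv))"
    unfolding EFK by unfold_locales (simp_all flip: L'.hom_mult)
  then have "L (chev q Kinv) = L' (chev q Kinv)"
    by (rule Uq_endo_Kinv[OF alg_iso_hom[OF assms(1)]])
  then show ?thesis
    using Uq_hom_unique[OF Uq_unital_algebra assms(1,2)[THEN alg_iso_hom] EFK]
    by (intro alg_iso_eqI[OF assms(1,2)])
qed

text \<open>
  \<open>L\<close> is the swap followed by the twist with \<open>c = - 1\<close> and \<open>t = 1\<close>; its dual is the composite in the
  opposite order.
\<close>

lemma lusztig_iso:
  "lusztig q \<in> alg_iso (Uq q) (Uq q) \<and>
   lusztig q (chev q E) = \<ominus>\<^bsub>Uq q\<^esub> (chev q F \<otimes>\<^bsub>Uq q\<^esub> chev q K) \<and>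
   lusztig q (chev q F) = \<ominus>\<^bsub>Uq q\<^esub> (chev q Kinv \<otimes>\<^bsub>Uq q\<^esub> chev q E) \<and>
   lusztig q (chev q K) = chev q Kinv"
    (is "?P (lusztig q)")
proof -
  obtain s where s: "s \<in> alg_iso (Uq q) (Uq q)" "s (chev q E) = chev q F" "s (chev q F) = chev q E"
      "s (chev q K) = chev q Kinv" "s (chev q Kinv) = chev q K"
    using swap_iso_exists by blast
  obtain w where w: "w \<in> alg_iso (Uq q) (Uq q)"
    "w (chev q E) = (- 1) \<odot>\<^bsub>Uq q\<^esub> (U.kpow (- 1) \<otimes>\<^bsub>Uq q\<^esub> chev q E)"
    "w (chev q F) = inverse (- 1) \<odot>\<^bsub>Uq q\<^esub> (chev q F \<otimes>\<^bsub>Uq q\<^esub> U.kpow 1)"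
    "w (chev q K) = chev q K" "w (chev q Kinv) = chev q Kinv"
    using twist_iso_exists[of "- 1" 1] unfolding U.kpow_def by auto
  have "?P (compose (carrier (Uq q)) w s)"
    using alg_iso_compose[OF Uq_unital_algebra s(1) w(1)]
    by (simp add: compose_eq s w U.kpow_m1 U.kpow_1 U.minus_eq_smult)
  moreover have "L = L'" if "?P L" "?P L'" for L L'
    using that Uq_endo_eqI[of L L'] by simp
  ultimately have "\<exists>!L. ?P L"
    by blast
  then show ?thesis
    unfolding lusztig_def by (rule theI')
qed

lemma lusztig_dual_iso:
  "lusztig_dual q \<in> alg_iso (Uq q) (Uq q) \<and>
   lusztig_dual q (chev q E) = \<ominus>\<^bsub>Uq q\<^esub> (chev q K \<otimes>\<^bsub>Uq q\<^esub> chev q F) \<and>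
   lusztig_dual q (chev q F) = \<ominus>\<^bsub>Uq q\<^esub> (chev q E \<otimes>\<^bsub>Uq q\<^esub> chev q Kinv) \<and>
   lusztig_dual q (chev q K) = chev q Kinv"
    (is "?P (lusztig_dual q)")
proof -
  obtain s where s: "s \<in> alg_iso (Uq q) (Uq q)" "s (chev q E) = chev q F" "s (chev q F) = chev q E"
      "s (chev q K) = chev q Kinv" "s (chev q Kinv) = chev q K"
    using swap_iso_exists by blast
  obtain w where w: "w \<in> alg_iso (Uq q) (Uq q)"
    "w (chev q E) = (- 1) \<odot>\<^bsub>Uq q\<^esub> (U.kpow (- 1) \<otimes>\<^bsub>Uq q\<^esub> chev q E)"
    "w (chev q F) = inverse (- 1) \<odot>\<^bsub>Uq q\<^esub> (chev q F \<otimes>\<^bsub>Uq q\<^esub> U.kpow 1)"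
    "w (chev q K) = chev q K" "w (chev q Kinv) = chev q Kinv"
    using twist_iso_exists[of "- 1" 1] unfolding U.kpow_def by auto
  interpret s: unital_algebra_hom "Uq q" "Uq q" s
    using alg_iso_hom[OF s(1)] by (rule Uq_homI)
  have "?P (compose (carrier (Uq q)) s w)"
    using alg_iso_compose[OF Uq_unital_algebra w(1) s(1)]
    by (simp add: compose_eq s w U.kpow_m1 U.kpow_1 U.minus_eq_smult)
  moreover have "L = L'" if "?P L" "?P L'" for L L'
    using that Uq_endo_eqI[of L L'] by simp
  ultimately have "\<exists>!L. ?P L"
    by blast
  then show ?thesis
    unfolding lusztig_dual_def by (rule theI')
qed

lemma primary_id_iso:
  fixes t :: int
  assumes "\<theta> \<noteq> 0"
  shows "primary_id q \<theta> t \<in> alg_iso (Ueq q) (Uq q) \<and>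
     primary_id q \<theta> t (equit q X) = chev q Kinv \<ominus>\<^bsub>Uq q\<^esub>
       (q powi (1 + t) * (q - inverse q) * inverse \<theta>) \<odot>\<^bsub>Uq q\<^esub>
         ((chev q K [^]\<^bsub>Uq q\<^esub> (- 1 - t)) \<otimes>\<^bsub>Uq q\<^esub> chev q E) \<and>
     primary_id q \<theta> t (equit q Y) = chev q K \<and>
     primary_id q \<theta> t (equit q Yinv) = chev q Kinv \<and>
     primary_id q \<theta> t (equit q Z) = chev q Kinv \<oplus>\<^bsub>Uq q\<^esub>
       (q powi (- t) * (q - inverse q) * \<theta>) \<odot>\<^bsub>Uq q\<^esub>
         (chev q F \<otimes>\<^bsub>Uq q\<^esub> (chev q K [^]\<^bsub>Uq q\<^esub> t))"
    (is "?P (primary_id q \<theta> t)")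
proof -
  obtain h where h: "h \<in> alg_iso (Ueq q) (Uq q)"
    "h (equit q X) = chev q Kinv \<ominus>\<^bsub>Uq q\<^esub>
      (q * (q - inverse q)) \<odot>\<^bsub>Uq q\<^esub> (chev q Kinv \<otimes>\<^bsub>Uq q\<^esub> chev q E)"
    "h (equit q Y) = chev q K" "h (equit q Yinv) = chev q Kinv"
    "h (equit q Z) = chev q Kinv \<oplus>\<^bsub>Uq q\<^esub> (q - inverse q) \<odot>\<^bsub>Uq q\<^esub> chev q F"
    using equitable_iso_exists by blast
  \<comment> \<open>The twist with this scalar takes the type \<open>(1, 0)\<close> to the type \<open>(\<theta>, t)\<close>.\<close>
  let ?c = "q powi t * inverse \<theta>"
  obtain w where w: "w \<in> alg_iso (Uq q) (Uq q)"
    "w (chev q E) = ?c \<odot>\<^bsub>Uq q\<^esub> (U.kpow (- t) \<otimes>\<^bsub>Uq q\<^esub> chev q E)"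
    "w (chev q F) = inverse ?c \<odot>\<^bsub>Uq q\<^esub> (chev q F \<otimes>\<^bsub>Uq q\<^esub> U.kpow t)"
    "w (chev q K) = chev q K" "w (chev q Kinv) = chev q Kinv"
    using twist_iso_exists[of ?c t] assms unfolding U.kpow_def by auto
  interpret w: unital_algebra_hom "Uq q" "Uq q" w
    using alg_iso_hom[OF w(1)] by (rule Uq_homI)
  have K: "chev q Kinv \<otimes>\<^bsub>Uq q\<^esub> (U.kpow (- t) \<otimes>\<^bsub>Uq q\<^esub> chev q E) = U.kpow (- 1 - t) \<otimes>\<^bsub>Uq q\<^esub> chev q E"
    unfolding U.kpow_m1[symmetric] by (simp add: U.kpow_kpow_left)
  have x: "w (chev q Kinv \<ominus>\<^bsub>Uq q\<^esub> (q * (q - inverse q)) \<odot>\<^bsub>Uq q\<^esub> (chev q Kinv \<otimes>\<^bsub>Uq q\<^esub> chev q E)) =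
      chev q Kinv \<ominus>\<^bsub>Uq q\<^esub> (q powi (1 + t) * (q - inverse q) * inverse \<theta>) \<odot>\<^bsub>Uq q\<^esub>
        (U.kpow (- 1 - t) \<otimes>\<^bsub>Uq q\<^esub> chev q E)"
    by (simp add: w K power_int_add mult_ac)
  have z: "w (chev q Kinv \<oplus>\<^bsub>Uq q\<^esub> (q - inverse q) \<odot>\<^bsub>Uq q\<^esub> chev q F) =
      chev q Kinv \<oplus>\<^bsub>Uq q\<^esub> (q powi (- t) * (q - inverse q) * \<theta>) \<odot>\<^bsub>Uq q\<^esub> (chev q F \<otimes>\<^bsub>Uq q\<^esub> U.kpow t)"
    by (simp add: w power_int_minus mult_ac)
  have "?P (compose (carrier (Ueq q)) w h)"
    using alg_iso_compose[OF Ueq_unital_algebra h(1) w(1)] x z w(4,5)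
    by (simp add: compose_eq h(2-5) U.kpow_def)
  moreover have "\<phi> = \<psi>" if "?P \<phi>" "?P \<psi>" for \<phi> \<psi>
    using that by (intro Ueq_iso_eqI[where q = q, OF _ _ Uq_unital_algebra[of q]]) simp_all
  ultimately have "\<exists>!\<phi>. ?P \<phi>"
    by blast
  then show ?thesis
    unfolding primary_id_def by (rule theI')
qed

text \<open>The secondary identification is the primary one followed by the swap.\<close>

lemma secondary_id_iso:
  fixes t :: int
  assumes "\<theta> \<noteq> 0"
  shows "secondary_id q \<theta> t \<in> alg_iso (Ueq q) (Uq q) \<and>
     secondary_id q \<theta> t (equit q X) = chev q K \<ominus>\<^bsub>Uq q\<^esub>
       (q powi (1 + t) * (q - inverse q) * inverse \<theta>) \<odot>\<^bsub>Uq q\<^esub>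
         ((chev q K [^]\<^bsub>Uq q\<^esub> (1 + t)) \<otimes>\<^bsub>Uq q\<^esub> chev q F) \<and>
     secondary_id q \<theta> t (equit q Y) = chev q Kinv \<and>
     secondary_id q \<theta> t (equit q Yinv) = chev q K \<and>
     secondary_id q \<theta> t (equit q Z) = chev q K \<oplus>\<^bsub>Uq q\<^esub>
       (q powi (- t) * (q - inverse q) * \<theta>) \<odot>\<^bsub>Uq q\<^esub>
         (chev q E \<otimes>\<^bsub>Uq q\<^esub> (chev q K [^]\<^bsub>Uq q\<^esub> (- t)))"
    (is "?P (secondary_id q \<theta> t)")
proof -
  obtain s where s: "s \<in> alg_iso (Uq q) (Uq q)" "s (chev q E) = chev q F" "s (chev q F) = chev q E"
      "s (chev q K) = chev q Kinv" "s (chev q Kinv) = chev q K"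
    using swap_iso_exists by blast
  interpret s: unital_algebra_hom "Uq q" "Uq q" s
    using alg_iso_hom[OF s(1)] by (rule Uq_homI)
  note p = primary_id_iso[OF assms, of t]
  have sk: "s (U.kpow r) = U.kpow (- r)" for r
    unfolding U.kpow_def by (simp add: s.hom_int_pow[OF U.inverse_pair_axioms] s U.k'_pow)
  have "?P (compose (carrier (Ueq q)) s (primary_id q \<theta> t))"
    using alg_iso_compose[OF Ueq_unital_algebra _ s(1), of "primary_id q \<theta> t"] p
    by (simp add: compose_eq s sk add.commute[of t 1] flip: U.kpow_def)
  moreover have "\<phi> = \<psi>" if "?P \<phi>" "?P \<psi>" for \<phi> \<psi>
    using that by (intro Ueq_iso_eqI[where q = q, OF _ _ Uq_unital_algebra[of q]]) simp_all
  ultimately have "\<exists>!\<phi>. ?P \<phi>"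
    by blast
  then show ?thesis
    unfolding secondary_id_def by (rule theI')
qed

end

section \<open>The Lusztig automorphisms in the equitable presentation\<close>

lemma neq_inverse_if_not_root_of_unity:
  fixes q :: "'a::field"
  assumes "q \<noteq> 0" "\<forall>n::nat. n > 0 \<longrightarrow> q ^ n \<noteq> 1"
  shows "q \<noteq> inverse q"
proof
  assume "q = inverse q"
  then have "q ^ 2 = 1"
    using \<open>q \<noteq> 0\<close> by (metis power2_eq_square right_inverse)
  then show False
    using assms(2) by (metis zero_less_numeral)
qed

theorem corollary5p17:
  fixes q \<theta> :: "'a::field" and t :: int
  assumes "q \<noteq> 0" and "\<forall>n::nat. n > 0 \<longrightarrow> q ^ n \<noteq> 1" and "\<theta> \<noteq> 0"
  shows "(\<theta>\<^sup>2 = q \<longrightarrow>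
      (\<forall>(\<phi>, M) \<in> {(primary_id q \<theta> t, lusztig q), (secondary_id q \<theta> t, lusztig_dual q)}.
        sends_under \<phi> M (nx q) (equit q Yinv \<otimes>\<^bsub>Ueq q\<^esub> nz q \<otimes>\<^bsub>Ueq q\<^esub> equit q Yinv) \<and>
        sends_under \<phi> M (equit q Y) (equit q Yinv) \<and>
        sends_under \<phi> M (nz q) (nx q) \<and>
        sends_under \<phi> (inv_into (carrier (Uq q)) M) (nx q) (nz q) \<and>
        sends_under \<phi> (inv_into (carrier (Uq q)) M) (equit q Y) (equit q Yinv) \<and>
        sends_under \<phi> (inv_into (carrier (Uq q)) M) (nz q)
          (equit q Yinv \<otimes>\<^bsub>Ueq q\<^esub> nx q \<otimes>\<^bsub>Ueq q\<^esub> equit q Yinv))) \<and>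
    (\<theta>\<^sup>2 = inverse q \<longrightarrow>
      (\<forall>(\<phi>, M) \<in> {(primary_id q \<theta> t, lusztig_dual q), (secondary_id q \<theta> t, lusztig q)}.
        sends_under \<phi> M (nx q) (equit q Yinv \<otimes>\<^bsub>Ueq q\<^esub> nz q \<otimes>\<^bsub>Ueq q\<^esub> equit q Yinv) \<and>
        sends_under \<phi> M (equit q Y) (equit q Yinv) \<and>
        sends_under \<phi> M (nz q) (nx q) \<and>
        sends_under \<phi> (inv_into (carrier (Uq q)) M) (nx q) (nz q) \<and>
        sends_under \<phi> (inv_into (carrier (Uq q)) M) (equit q Y) (equit q Yinv) \<and>
        sends_under \<phi> (inv_into (carrier (Uq q)) M) (nz q)
          (equit q Yinv \<otimes>\<^bsub>Ueq q\<^esub> nx q \<otimes>\<^bsub>Ueq q\<^esub> equit q Yinv)))"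
proof -
  have q: "q \<noteq> 0" "q \<noteq> inverse q"
    using assms neq_inverse_if_not_root_of_unity by auto
  interpret U: chevalley_elements "Uq q" "chev q K" "chev q Kinv" q "chev q E" "chev q F"
    by (rule chev_chevalley_elements[OF q])
  interpret U': chevalley_elements "Uq q" "chev q Kinv" "chev q K" q "chev q F" "chev q E"
    by (rule U.chevalley_swap)
  note L = lusztig_iso[OF q] and Ld = lusztig_dual_iso[OF q]
  have LKinv: "lusztig q (chev q Kinv) = chev q K" "lusztig_dual q (chev q Kinv) = chev q K"
    using L Ld U'.inverse_pair_axioms by (auto intro!: Uq_endo_Kinv[OF q] alg_iso_hom)
  note p = primary_id_iso[OF q \<open>\<theta> \<noteq> 0\<close>, of t]
  \<comment> \<open>Powers of \<open>k\<close> are rewritten as powers of \<open>k'\<close>, to read as a primary identification in \<open>U'\<close>.\<close>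
  have s: "secondary_id q \<theta> t \<in> alg_hom (Ueq q) (Uq q)"
    "secondary_id q \<theta> t (equit q X) = chev q K \<ominus>\<^bsub>Uq q\<^esub>
       (q powi (1 + t) * (q - inverse q) * inverse \<theta>) \<odot>\<^bsub>Uq q\<^esub>
         ((chev q Kinv [^]\<^bsub>Uq q\<^esub> (- 1 - t)) \<otimes>\<^bsub>Uq q\<^esub> chev q F)"
    "secondary_id q \<theta> t (equit q Y) = chev q Kinv"
    "secondary_id q \<theta> t (equit q Yinv) = chev q K"
    "secondary_id q \<theta> t (equit q Z) = chev q K \<oplus>\<^bsub>Uq q\<^esub>
       (q powi (- t) * (q - inverse q) * \<theta>) \<odot>\<^bsub>Uq q\<^esub>
         (chev q E \<otimes>\<^bsub>Uq q\<^esub> (chev q Kinv [^]\<^bsub>Uq q\<^esub> t))"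
    using secondary_id_iso[OF q \<open>\<theta> \<noteq> 0\<close>, of t] by (simp_all add: alg_iso_hom U.k'_pow add.commute)
  \<comment> \<open>Since \<open>k f = c f k\<close>, this is the scalar that distinguishes the dual automorphism from \<open>L\<close>.\<close>
  define c where "c = q powi (- 2)"
  have c: "c \<noteq> 0" "q * c = inverse q" "q powi 2 = inverse c"
    using q by (simp_all add: c_def power_int_minus power2_eq_square)
  have FK: "chev q K \<otimes>\<^bsub>Uq q\<^esub> chev q F = c \<odot>\<^bsub>Uq q\<^esub> (chev q F \<otimes>\<^bsub>Uq q\<^esub> chev q K)"
    "chev q E \<otimes>\<^bsub>Uq q\<^esub> chev q Kinv = inverse c \<odot>\<^bsub>Uq q\<^esub> (chev q Kinv \<otimes>\<^bsub>Uq q\<^esub> chev q E)"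
    "chev q Kinv \<otimes>\<^bsub>Uq q\<^esub> chev q E = c \<odot>\<^bsub>Uq q\<^esub> (chev q E \<otimes>\<^bsub>Uq q\<^esub> chev q Kinv)"
    "chev q F \<otimes>\<^bsub>Uq q\<^esub> chev q K = inverse c \<odot>\<^bsub>Uq q\<^esub> (chev q K \<otimes>\<^bsub>Uq q\<^esub> chev q F)"
    using c(1) U.k_f U'.k_f by (simp_all flip: c_def)
  have flips:
    "\<theta>\<^sup>2 = q \<Longrightarrow> equitable_flip q (Uq q) (primary_id q \<theta> t) (lusztig q)"
    "\<theta>\<^sup>2 = q \<Longrightarrow> equitable_flip q (Uq q) (secondary_id q \<theta> t) (lusztig_dual q)"
    "\<theta>\<^sup>2 = inverse q \<Longrightarrow> equitable_flip q (Uq q) (primary_id q \<theta> t) (lusztig_dual q)"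
    "\<theta>\<^sup>2 = inverse q \<Longrightarrow> equitable_flip q (Uq q) (secondary_id q \<theta> t) (lusztig q)"
  proof -
    assume "\<theta>\<^sup>2 = q"
    then show "equitable_flip q (Uq q) (primary_id q \<theta> t) (lusztig q)"
      using p L \<open>\<theta> \<noteq> 0\<close>
      by (intro U.equitable_flip_of_images[where c = 1 and \<theta> = \<theta> and t = t])
        (simp_all add: alg_iso_hom U.minus_eq_smult)
  next
    assume "\<theta>\<^sup>2 = q"
    then show "equitable_flip q (Uq q) (secondary_id q \<theta> t) (lusztig_dual q)"
      using s Ld LKinv \<open>\<theta> \<noteq> 0\<close>
      by (intro U'.equitable_flip_of_images[where c = 1 and \<theta> = \<theta> and t = t])
        (simp_all add: U.minus_eq_smult)
  next
    assume "\<theta>\<^sup>2 = inverse q"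
    then show "equitable_flip q (Uq q) (primary_id q \<theta> t) (lusztig_dual q)"
      using p Ld \<open>\<theta> \<noteq> 0\<close> c
      by (intro U.equitable_flip_of_images[where c = c and \<theta> = \<theta> and t = t])
        (simp_all add: alg_iso_hom U.minus_smult FK(1,2))
  next
    assume "\<theta>\<^sup>2 = inverse q"
    then show "equitable_flip q (Uq q) (secondary_id q \<theta> t) (lusztig q)"
      using s L LKinv \<open>\<theta> \<noteq> 0\<close> c
      by (intro U'.equitable_flip_of_images[where c = c and \<theta> = \<theta> and t = t])
        (simp_all add: U.minus_smult FK(3,4))
  qed
  show ?thesis
    unfolding equitable_flip_def[symmetric] using flips by simp
qed

end
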